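(* Let $n\ge2$, let $K$ be an $n$-dimensional convex body and $o\in\operatorname{int}K$. Then $$\limsup_{r\to\infty}\frac{\log\operatorname{Area}(S(r))}{r}=\overline{\operatorname{Ent}}\,K,\qquad \liminf_{r\to\infty}\frac{\log\operatorname{Area}(S(r))}{r}=\underline{\operatorname{Ent}}\,K,$$ where $S(r)$ is the metric sphere of radius $r$ centered at $o$ in the Hilbert geometry of $K$. That is, the upper and lower spherical entropies coincide with the upper and lower volume entropies.
   Context: A convex body is a compact convex set $K$ with non-empty interior in an $n$-dimensional real vector space. For distinct $x,y\in\operatorname{int}K$ let $a,b$ be the intersection points of the line $xy$ with $\partial K$, in the order $a,x,y,b$. The Hilbert distance is $d(x,y)=\frac12\log\frac{|a-y|\,|b-x|}{|a-x|\,|b-y|}$. It is induced by the Finsler norm $\|v\|_x=\frac12\left(\frac1{t_1}+\frac1{t_2}\right)$ for $v\ne0$, where $t_1,t_2>0$ and $x+t_1v,\ x-t_2v\in\partial K$. $B(r)$ and $S(r)$ denote the metric ball and metric sphere of radius $r$ centered at $o$. $\operatorname{Vol}$ is Busemann's volume: $\operatorname{Vol}(A)=\int_A\sigma\,d\mathcal L$ with $\sigma(x)=\omega_n/\mathcal L(\{v:\|v\|_x\le1\})$, $\mathcal L$ a Lebesgue measure normalized by a Euclidean inner product, and $\omega_n$ the volume of the Euclidean unit ball of $\mathbb R^n$; it equals the $n$-dimensional Hausdorff measure of $d$. $\operatorname{Area}$ is Busemann's area of hypersurfaces, i.e. the $(n-1)$-dimensional Hausdorff measure with respect to $d$. $\overline{\operatorname{Ent}}\,K=\limsup_{r\to\infty}\frac{\log\operatorname{Vol}B(r)}{r}$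 and $\underline{\operatorname{Ent}}\,K=\liminf_{r\to\infty}\frac{\log\operatorname{Vol}B(r)}{r}$. *)

theory Defs
  imports "HOL-Analysis.Analysis"
begin

definition convex_body :: "'a::euclidean_space set \<Rightarrow> bool" where
  "convex_body K \<longleftrightarrow> compact K \<and> convex K \<and> interior K \<noteq> {}"

subsection \<open>The Hilbert distance and its Finsler norm\<close>

text \<open>The point where the ray from \<open>x\<close> through \<open>y\<close> leaves \<open>K\<close>; it exists and is unique for
  distinct \<open>x\<close>, \<open>y\<close> in the interior of a convex body.\<close>

definition exit_point :: "'a::euclidean_space set \<Rightarrow> 'a \<Rightarrow> 'a \<Rightarrow> 'a" where
  "exit_point K x y = (THE b. b \<in> frontier K \<and> y \<in> open_segment x b)"

definition hilbert_dist :: "'a::euclidean_space set \<Rightarrow> 'a \<Rightarrow> 'a \<Rightarrow> real" where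
  "hilbert_dist K x y =
     (if x = y then 0
      else let a = exit_point K y x; b = exit_point K x y
           in 1 / 2 * ln ((dist a y * dist b x) / (dist a x * dist b y)))"

definition exit_time :: "'a::euclidean_space set \<Rightarrow> 'a \<Rightarrow> 'a \<Rightarrow> real" where
  "exit_time K x v = (THE t. t > 0 \<and> x + t *\<^sub>R v \<in> frontier K)"

definition hilbert_norm :: "'a::euclidean_space set \<Rightarrow> 'a \<Rightarrow> 'a \<Rightarrow> real" where
  "hilbert_norm K x v =
     (if v = 0 then 0 else 1 / 2 * (1 / exit_time K x v + 1 / exit_time K x (- v)))"

definition hilbert_ball :: "'a::euclidean_space set \<Rightarrow> 'a \<Rightarrow> real \<Rightarrow> 'a set" where
  "hilbert_ball K p r = {x \<in> interior K. hilbert_dist K p x \<le> r}"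

definition hilbert_sphere :: "'a::euclidean_space set \<Rightarrow> 'a \<Rightarrow> real \<Rightarrow> 'a set" where
  "hilbert_sphere K p r = {x \<in> interior K. hilbert_dist K p x = r}"

subsection \<open>Busemann volume\<close>

definition busemann_density :: "'a::euclidean_space set \<Rightarrow> 'a \<Rightarrow> real" where
  "busemann_density K x =
     unit_ball_vol (real DIM('a)) / measure lborel {v. hilbert_norm K x v \<le> 1}"

definition busemann_vol :: "'a::euclidean_space set \<Rightarrow> 'a set \<Rightarrow> ennreal" where
  "busemann_vol K A = (\<integral>\<^sup>+x\<in>A. ennreal (busemann_density K x) \<partial>lborel)"

subsection \<open>Hausdorff measure and Busemann area\<close>

definition diam_of :: "('a \<Rightarrow> 'a \<Rightarrow> real) \<Rightarrow> 'a set \<Rightarrow> ennreal" where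
  "diam_of d E = (SUP x\<in>E. SUP y\<in>E. ennreal (d x y))"

text \<open>The \<open>s\<close>-dimensional Hausdorff (outer) measure of the metric space \<open>(M, d)\<close>, with the factor
  \<open>\<omega>\<^sub>s / 2\<^sup>s\<close> for which it is the Lebesgue measure on Euclidean \<open>s\<close>-space.  Empty members
  of a cover contribute \<open>0\<close> also when \<open>s = 0\<close>.\<close>

definition hausdorff_premeasure ::
    "'a set \<Rightarrow> ('a \<Rightarrow> 'a \<Rightarrow> real) \<Rightarrow> nat \<Rightarrow> real \<Rightarrow> 'a set \<Rightarrow> ennreal" where
  "hausdorff_premeasure M d s \<delta> A =
     (INF E \<in> {E :: nat \<Rightarrow> 'a set.
                 (\<forall>i. E i \<subseteq> M \<and> diam_of d (E i) \<le> ennreal \<delta>) \<and> A \<subseteq> (\<Union>i. E i)}.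
        \<Sum>i. if E i = {} then 0
            else ennreal (unit_ball_vol (real s) / 2 ^ s) * diam_of d (E i) ^ s)"

definition hausdorff_measure ::
    "'a set \<Rightarrow> ('a \<Rightarrow> 'a \<Rightarrow> real) \<Rightarrow> nat \<Rightarrow> 'a set \<Rightarrow> ennreal" where
  "hausdorff_measure M d s A = (SUP \<delta>\<in>{0<..}. hausdorff_premeasure M d s \<delta> A)"

definition busemann_area :: "'a::euclidean_space set \<Rightarrow> 'a set \<Rightarrow> ennreal" where
  "busemann_area K A = hausdorff_measure (interior K) (hilbert_dist K) (DIM('a) - 1) A"

subsection \<open>Entropies\<close>

definition ln_ennreal :: "ennreal \<Rightarrow> ereal" where
  "ln_ennreal x =
     (if x = 0 then -\<infinity> else if x = \<infinity> then \<infinity> else ereal (ln (enn2real x)))"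

definition upper_vol_entropy :: "'a::euclidean_space set \<Rightarrow> 'a \<Rightarrow> ereal" where
  "upper_vol_entropy K p =
     Limsup at_top (\<lambda>r::real. ln_ennreal (busemann_vol K (hilbert_ball K p r)) / ereal r)"

definition lower_vol_entropy :: "'a::euclidean_space set \<Rightarrow> 'a \<Rightarrow> ereal" where
  "lower_vol_entropy K p =
     Liminf at_top (\<lambda>r::real. ln_ennreal (busemann_vol K (hilbert_ball K p r)) / ereal r)"

end

theory Submission
  imports Defs "HOL-Real_Asymp.Real_Asymp"
begin

text \<open>
  Write \<open>n\<close> for the dimension, \<open>d\<close> for the Hilbert distance and \<open>V r\<close>, \<open>A r\<close> for the volume of
  the ball and the area of the sphere of radius \<open>r\<close> about \<open>p\<close>. The theorem follows from the two
  inequalities \<open>V r \<le> D (r + 1) A r\<close> (\<open>vol_le_area\<close>) and \<open>A r \<le> C V (r + 2)\<close> (\<open>area_le_vol\<close>),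
  whose constants depend on \<open>n\<close> only: since \<open>V r\<close> grows at most exponentially
  (\<open>emeasure_ball_le_exp\<close>), the factors and the shift of the radius disappear in \<open>ln (A r) / r\<close>
  and \<open>ln (V r) / r\<close> as \<open>r \<rightarrow> \<infinity>\<close>.

  Both inequalities rest on two facts. The first is that radial projection between spheres about
  \<open>p\<close> is 2-Lipschitz towards the centre. A homothety with centre \<open>p\<close> and ratio at most 1 maps
  \<open>K\<close> into itself, hence contracts \<open>d\<close>; two points of a sphere need different ratios to be
  brought to the same smaller sphere, but rays from \<open>p\<close> are geodesics, so the second ratio can
  be corrected at the cost of a distance that the contraction already controls
  (\<open>hilbert_dist_homotheties_le\<close>). The second is that a ball of radius \<open>\<rho> \<le> 1/2\<close> has volume
  between two multiples of \<open>\<rho>\<^sup>n\<close> depending on \<open>n\<close> only (\<open>emeasure_small_ball_le\<close>,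
  \<open>emeasure_small_ball_ge\<close>): the Finsler norms at points of distance at most \<open>\<rho>\<close> differ by a
  factor of at most \<open>exp (2 \<rho>)\<close>, and the ball is comparable to a tangent ball at its centre, on
  which the Busemann density is normalised.

  To bound volume by area, cover the sphere by sets \<open>E\<^sub>i\<close> of small diameters \<open>\<eta>\<^sub>i\<close>. The cones
  over them with apex \<open>p\<close> cover the ball, and the Lipschitz property cuts the cone over \<open>E\<^sub>i\<close>
  into about \<open>r / \<eta>\<^sub>i\<close> slices of diameter of order \<open>\<eta>\<^sub>i\<close>, so its volume is of order
  \<open>(r + 1) \<eta>\<^sub>i\<^sup>n\<^sup>-\<^sup>1\<close>. To bound area by volume, take a maximal \<open>\<delta>\<close>-separated subset of the
  sphere of radius \<open>r\<close> and push it outwards to the about \<open>1 / \<delta>\<close> spheres of radii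
  \<open>r + j \<delta> \<le> r + 1\<close>. The resulting points are still \<open>\<delta> / 2\<close>-separated, so small balls about them
  are disjoint, and a subset of size \<open>N\<close> forces \<open>V (r + 2)\<close> to be at least of order \<open>N \<delta>\<^sup>n\<^sup>-\<^sup>1\<close>,
  which up to a constant is the Hausdorff sum of the cover by \<open>\<delta>\<close>-balls about the subset.

  The estimates on \<open>d\<close> itself become simple once \<open>d\<close> is written as the mean of the two Funk
  distances \<open>F x y\<close> and \<open>F y x\<close>, because \<open>F x y \<le> \<rho>\<close> says that \<open>K - y\<close> contains the copy of
  \<open>K - x\<close> scaled by \<open>exp (- \<rho>)\<close> (\<open>funk_dist_le_iff\<close>).
\<close>

section \<open>Real and measure-theoretic preliminaries\<close>

text \<open>Norms of \<open>K\<close> are compared through membership \<open>x + t v \<in> K\<close>, that is, through the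
  inequality \<open>norm * t \<le> 1\<close>; these inequalities determine the norm.\<close>

lemma nonneg_eq_by_sublevels:
  assumes "\<And>t. 0 < t \<Longrightarrow> a * t \<le> 1 \<longleftrightarrow> b * t \<le> (1::real)" "0 \<le> a" "0 \<le> b"
  shows "a = b"
proof -
  have "x \<le> y" if "\<And>t. 0 < t \<Longrightarrow> x * t \<le> 1 \<longleftrightarrow> y * t \<le> (1::real)" "0 \<le> x" "0 \<le> y" for x y
  proof (rule ccontr)
    assume "\<not> x \<le> y"
    then have "y < (x + y) / 2" "(x + y) / 2 < x" "0 < (x + y) / 2" using that by auto
    \<comment> \<open>the reciprocal of the midpoint separates the two inequalities\<close>
    then show False using that(1)[of "1 / ((x + y) / 2)"] by (auto simp: field_simps)
  qed
  then show ?thesis using assms by (meson order_antisym)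
qed

lemma affine_image_borel:
  fixes x :: "'a::euclidean_space"
  assumes "c \<noteq> 0" "S \<in> sets borel"
  shows "(\<lambda>v. c *\<^sub>R v + x) ` S \<in> sets borel"
proof -
  have "(\<lambda>v. c *\<^sub>R v + x) ` S = (\<lambda>w. (1 / c) *\<^sub>R (w - x)) -` S"
    using assms(1) by (auto simp: image_iff intro!: bexI[rotated])
  also have "\<dots> \<in> sets borel" by (rule measurable_sets_borel[OF _ assms(2)]) measurable
  finally show ?thesis .
qed

lemma measure_affine_image:
  fixes x :: "'a::euclidean_space"
  assumes "0 < c" "S \<in> sets borel"
  shows "measure lborel ((\<lambda>v. c *\<^sub>R v + x) ` S) = c ^ DIM('a) * measure lborel S"
  using measure_lebesgue_affine[of c x S] assms affine_image_borel[of c S x]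
  by (simp add: measure_completion)

lemma dist_le_diam_of:
  assumes "x \<in> E" "y \<in> E"
  shows "ennreal (d x y) \<le> diam_of d E"
  unfolding diam_of_def by (rule SUP_upper2[OF assms(1)], rule SUP_upper[OF assms(2)])

lemma ln_ennreal_ennreal:
  assumes "0 < x"
  shows "ln_ennreal (ennreal x) = ereal (ln x)"
  using assms by (simp add: ln_ennreal_def ennreal_eq_0_iff)

text \<open>It suffices that the error is eventually below each constant \<open>d > 0\<close>, since constants pass
  through \<open>Limsup\<close> and \<open>Liminf\<close>.\<close>

lemma Limsup_Liminf_le_of_asymptotic_le:
  fixes f g e :: "real \<Rightarrow> real"
  assumes le: "\<forall>\<^sub>F r in at_top. f r \<le> g r + e r" and e: "(e \<longlongrightarrow> 0) at_top"
  shows "Limsup at_top (\<lambda>r. ereal (f r)) \<le> Limsup at_top (\<lambda>r. ereal (g r))"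
    and "Liminf at_top (\<lambda>r. ereal (f r)) \<le> Liminf at_top (\<lambda>r. ereal (g r))"
proof -
  have ev: "\<forall>\<^sub>F r in at_top. ereal (f r) \<le> ereal (g r) + ereal d" if "0 < d" for d
    using le order_tendstoD(2)[OF e that] by eventually_elim simp
  show "Limsup at_top (\<lambda>r. ereal (f r)) \<le> Limsup at_top (\<lambda>r. ereal (g r))"
  proof (rule ereal_le_epsilon2)
    fix d :: real assume "0 < d"
    then show "Limsup at_top (\<lambda>r. ereal (f r)) \<le> Limsup at_top (\<lambda>r. ereal (g r)) + ereal d"
      using Limsup_mono[OF ev[of d]] by (subst Limsup_add_ereal_right[symmetric]) auto
  qed
  show "Liminf at_top (\<lambda>r. ereal (f r)) \<le> Liminf at_top (\<lambda>r. ereal (g r))"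
  proof (rule ereal_le_epsilon2)
    fix d :: real assume "0 < d"
    then show "Liminf at_top (\<lambda>r. ereal (f r)) \<le> Liminf at_top (\<lambda>r. ereal (g r)) + ereal d"
      using Liminf_mono[OF ev[of d]] by (subst Liminf_add_ereal_right[symmetric]) auto
  qed
qed

lemma filtermap_shift_at_top: "filtermap (\<lambda>r. r + c) at_top = (at_top :: real filter)"
proof (rule filter_eq_iff[THEN iffD2], rule allI)
  fix P :: "real \<Rightarrow> bool"
  have "(\<exists>N. \<forall>n\<ge>N. P (n + c)) \<longleftrightarrow> (\<exists>N. \<forall>n\<ge>N. P n)"
  proof
    assume "\<exists>N. \<forall>n\<ge>N. P (n + c)"
    then obtain N where N: "\<And>n. N \<le> n \<Longrightarrow> P (n + c)" by blast
    have "P n" if "N + c \<le> n" for n using N[of "n - c"] that by simp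
    then show "\<exists>N. \<forall>n\<ge>N. P n" by blast
  next
    assume "\<exists>N. \<forall>n\<ge>N. P n"
    then obtain N where N: "\<And>n. N \<le> n \<Longrightarrow> P n" by blast
    have "P (n + c)" if "N - c \<le> n" for n using N[of "n + c"] that by simp
    then show "\<exists>N. \<forall>n\<ge>N. P (n + c)" by blast
  qed
  then show "eventually P (filtermap (\<lambda>r. r + c) at_top) \<longleftrightarrow> eventually P at_top"
    by (simp add: eventually_filtermap eventually_at_top_linorder)
qed

lemma Limsup_Liminf_shift:
  fixes f :: "real \<Rightarrow> ereal"
  shows "Limsup at_top (\<lambda>r. f (r + c)) = Limsup at_top f"
    and "Liminf at_top (\<lambda>r. f (r + c)) = Liminf at_top f"
proof -
  have "inj (\<lambda>r::real. r + c)" by (simp add: inj_def)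
  from Limsup_filtermap_eq[OF this, of at_top f] Liminf_filtermap_eq[OF this, of at_top f]
  show "Limsup at_top (\<lambda>r. f (r + c)) = Limsup at_top f"
    "Liminf at_top (\<lambda>r. f (r + c)) = Liminf at_top f"
    by (simp_all add: filtermap_shift_at_top)
qed

section \<open>The Funk norm and the Funk distance\<close>

locale hilbert_geometry =
  fixes K :: "'a::euclidean_space set"
  assumes body: "convex_body K"
begin

lemma compact_K: "compact K" and convex_K: "convex K" and closed_K: "closed K"
  using body compact_imp_closed by (auto simp: convex_body_def)

lemma exit_time_exists:
  assumes "x \<in> interior K" "v \<noteq> 0"
  obtains t where "0 < t" "x + t *\<^sub>R v \<in> frontier K"
  using ray_to_frontier[OF compact_imp_bounded[OF compact_K] assms] by blast

lemma interior_before_boundary: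
  assumes x: "x \<in> interior K" and t: "x + t *\<^sub>R v \<in> K" and s: "0 \<le> s" "s < t"
  shows "x + s *\<^sub>R v \<in> interior K"
proof (cases "v = 0 \<or> s = 0")
  case True
  then show ?thesis using x by auto
next
  case False
  have "open_segment x (x + t *\<^sub>R v) \<subseteq> interior K"
    using in_interior_closure_convex_segment[OF convex_K x] t closure_subset by blast
  moreover have "x + s *\<^sub>R v \<in> open_segment x (x + t *\<^sub>R v)"
    unfolding in_segment using False s
    by (intro conjI exI[of _ "s / t"]) (auto simp: algebra_simps)
  ultimately show ?thesis by blast
qed

lemma exit_time_unique:
  assumes x: "x \<in> interior K" and t: "0 < t" "x + t *\<^sub>R v \<in> frontier K"
  shows "exit_time K x v = t"
  unfolding exit_time_def
proof (rule the_equality)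
  show "0 < t \<and> x + t *\<^sub>R v \<in> frontier K" using t by simp
next
  fix s assume s: "0 < s \<and> x + s *\<^sub>R v \<in> frontier K"
  have "\<not> a < b" if "0 < a" "x + a *\<^sub>R v \<in> frontier K" "x + b *\<^sub>R v \<in> frontier K" for a b
    using interior_before_boundary[OF x, of b v a] that closed_K frontier_subset_closed[OF closed_K]
    by (auto simp: frontier_def)
  then show "s = t" using s t by (meson linorder_less_linear)
qed

lemma exit_time:
  assumes "x \<in> interior K" "v \<noteq> 0"
  shows exit_time_pos: "0 < exit_time K x v"
    and exit_time_frontier: "x + exit_time K x v *\<^sub>R v \<in> frontier K"
proof -
  obtain t where "0 < t" "x + t *\<^sub>R v \<in> frontier K"
    using exit_time_exists[OF assms] .
  then show "0 < exit_time K x v" "x + exit_time K x v *\<^sub>R v \<in> frontier K"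
    using exit_time_unique[OF assms(1)] by auto
qed

text \<open>The gauge of \<open>K - x\<close>: the Hilbert norm of \<open>v\<close> is the mean of its values at \<open>v\<close> and \<open>- v\<close>.\<close>

definition funk_norm :: "'a \<Rightarrow> 'a \<Rightarrow> real" where
  "funk_norm x v = (if v = 0 then 0 else 1 / exit_time K x v)"

lemma funk_norm_zero [simp]: "funk_norm x 0 = 0"
  by (simp add: funk_norm_def)

lemma funk_norm_nonneg: "x \<in> interior K \<Longrightarrow> 0 \<le> funk_norm x v"
  using exit_time_pos[of x v] by (auto simp: funk_norm_def)

text \<open>All later use of the exit time goes through this translation between the norm and
  membership in \<open>K\<close>.\<close>

lemma ray_mem_iff:
  assumes x: "x \<in> interior K" and t: "0 \<le> t"
  shows "x + t *\<^sub>R v \<in> K \<longleftrightarrow> t * funk_norm x v \<le> 1"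
    and "x + t *\<^sub>R v \<in> interior K \<longleftrightarrow> t * funk_norm x v < 1"
proof -
  consider "v = 0" | "v \<noteq> 0" by blast
  then have "(x + t *\<^sub>R v \<in> K \<longleftrightarrow> t * funk_norm x v \<le> 1) \<and>
      (x + t *\<^sub>R v \<in> interior K \<longleftrightarrow> t * funk_norm x v < 1)"
  proof cases
    case 1
    then show ?thesis using x interior_subset by auto
  next
    case 2
    define T where "T = exit_time K x v"
    have T: "0 < T" "x + T *\<^sub>R v \<in> frontier K"
      unfolding T_def using exit_time_pos exit_time_frontier x 2 by auto
    have in_K: "x + T *\<^sub>R v \<in> K" and not_int: "x + T *\<^sub>R v \<notin> interior K"
      using T frontier_subset_closed[OF closed_K] by (auto simp: frontier_def)
    have lt: "x + t *\<^sub>R v \<in> interior K" if "t < T"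
      using interior_before_boundary[OF x in_K t that] .
    have gt: "x + t *\<^sub>R v \<notin> K" if "T < t"
      using interior_before_boundary[OF x _ less_imp_le[OF T(1)] that] not_int by blast
    have fn: "funk_norm x v = 1 / T" using 2 by (simp add: funk_norm_def T_def)
    have "t * funk_norm x v \<le> 1 \<longleftrightarrow> t \<le> T" "t * funk_norm x v < 1 \<longleftrightarrow> t < T"
      unfolding fn using T(1) by (simp_all add: field_simps)
    then show ?thesis
      using lt gt in_K not_int interior_subset[of K]
      by (cases t T rule: linorder_cases) auto
  qed
  then show "x + t *\<^sub>R v \<in> K \<longleftrightarrow> t * funk_norm x v \<le> 1"
    "x + t *\<^sub>R v \<in> interior K \<longleftrightarrow> t * funk_norm x v < 1" by auto
qed

lemma funk_norm_le_iff:
  assumes "x \<in> interior K" "0 < c"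
  shows "funk_norm x v \<le> c \<longleftrightarrow> x + (1 / c) *\<^sub>R v \<in> K"
  using ray_mem_iff(1)[OF assms(1), of "1 / c" v] assms(2) by (simp add: field_simps)

lemma funk_norm_scale:
  assumes x: "x \<in> interior K" and c: "0 \<le> c"
  shows "funk_norm x (c *\<^sub>R v) = c * funk_norm x v"
proof (rule nonneg_eq_by_sublevels)
  fix t :: real assume "0 < t"
  then show "funk_norm x (c *\<^sub>R v) * t \<le> 1 \<longleftrightarrow> c * funk_norm x v * t \<le> 1"
    using ray_mem_iff(1)[OF x, of t "c *\<^sub>R v"] ray_mem_iff(1)[OF x, of "t * c" v] c
    by (simp add: mult_ac)
qed (use x c funk_norm_nonneg in auto)

lemma hilbert_norm_eq: "hilbert_norm K x v = (funk_norm x v + funk_norm x (- v)) / 2"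
  by (simp add: hilbert_norm_def funk_norm_def)

text \<open>If \<open>b\<close> is the exit point of the ray from \<open>x\<close> through \<open>y\<close>, this is the logarithm of
  \<open>\<bar>x - b\<bar> / \<bar>y - b\<bar>\<close>.\<close>

definition funk_dist :: "'a \<Rightarrow> 'a \<Rightarrow> real" where
  "funk_dist x y = - ln (1 - funk_norm x (y - x))"

lemma funk_norm_diff_less_1:
  assumes "x \<in> interior K" "y \<in> interior K"
  shows "funk_norm x (y - x) < 1"
  using ray_mem_iff(2)[OF assms(1), of 1 "y - x"] assms(2) by simp

lemma funk_dist_nonneg:
  assumes "x \<in> interior K" "y \<in> interior K"
  shows "0 \<le> funk_dist x y"
  using funk_norm_diff_less_1[OF assms] funk_norm_nonneg[OF assms(1)]
  by (simp add: funk_dist_def)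

text \<open>Whether \<open>K - y\<close> contains the copy of \<open>K - x\<close> scaled by \<open>s\<close> is decided by the exit point
  \<open>b\<close> of the ray from \<open>x\<close> through \<open>y\<close>. If \<open>s (b - x)\<close> still fits, then \<open>s \<le> \<bar>b - y\<bar> / \<bar>b - x\<bar>\<close>;
  conversely, for such \<open>s < 1\<close> each \<open>y + s (k - x)\<close> is a convex combination of \<open>k\<close> and of the
  point \<open>x + (y - x) / (1 - s)\<close>, which does not lie beyond \<open>b\<close>.\<close>

lemma funk_dist_le_iff:
  assumes x: "x \<in> interior K" and y: "y \<in> interior K" and r: "0 \<le> r"
  shows "funk_dist x y \<le> r \<longleftrightarrow> (\<forall>k\<in>K. y + exp (- r) *\<^sub>R (k - x) \<in> K)"
proof -
  define g where "g = funk_norm x (y - x)"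
  define s where "s = exp (- r)"
  have g: "0 \<le> g" "g < 1"
    using funk_norm_nonneg[OF x] funk_norm_diff_less_1[OF x y] by (auto simp: g_def)
  have s: "0 < s" "s \<le> 1" using r by (auto simp: s_def)
  have "funk_dist x y \<le> r \<longleftrightarrow> - r \<le> ln (1 - g)" by (auto simp: funk_dist_def g_def)
  also have "\<dots> \<longleftrightarrow> s \<le> 1 - g" using g unfolding s_def by (subst ln_ge_iff) auto
  also have "\<dots> \<longleftrightarrow> (\<forall>k\<in>K. y + s *\<^sub>R (k - x) \<in> K)"
  proof
    assume le: "s \<le> 1 - g"
    show "\<forall>k\<in>K. y + s *\<^sub>R (k - x) \<in> K"
    proof
      fix k assume k: "k \<in> K"
      show "y + s *\<^sub>R (k - x) \<in> K"
      proof (cases "s = 1")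
        case True
        then have "g = 0" using le g by auto
        then have "y = x"
          using exit_time_pos[OF x, of "y - x"] by (auto simp: g_def funk_norm_def split: if_splits)
        then show ?thesis using k True by simp
      next
        case False
        then have s1: "0 < 1 - s" using s by simp
        have "x + (1 / (1 - s)) *\<^sub>R (y - x) \<in> K"
          using funk_norm_le_iff[OF x s1, of "y - x"] le by (simp add: g_def)
        from convexD[OF convex_K this k, of "1 - s" s] s s1
        have "(1 - s) *\<^sub>R (x + (1 / (1 - s)) *\<^sub>R (y - x)) + s *\<^sub>R k \<in> K" by simp
        also have "(1 - s) *\<^sub>R (x + (1 / (1 - s)) *\<^sub>R (y - x)) + s *\<^sub>R k = y + s *\<^sub>R (k - x)"
          using s1 by (simp add: algebra_simps)
        finally show ?thesis .
      qed
    qed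
  next
    assume R: "\<forall>k\<in>K. y + s *\<^sub>R (k - x) \<in> K"
    show "s \<le> 1 - g"
    proof (cases "g = 0")
      case True
      then show ?thesis using s by simp
    next
      case False
      then have gp: "0 < g" using g by simp
      then have "x + (1 / g) *\<^sub>R (y - x) \<in> K"
        using funk_norm_le_iff[OF x, of g "y - x"] by (simp add: g_def)
      with R have "y + s *\<^sub>R (1 / g) *\<^sub>R (y - x) \<in> K" by fastforce
      then have "x + (1 + s / g) *\<^sub>R (y - x) \<in> K" by (simp add: algebra_simps)
      then have "(1 + s / g) * g \<le> 1"
        using ray_mem_iff(1)[OF x, of "1 + s / g" "y - x"] gp s by (simp add: g_def)
      moreover have "(1 + s / g) * g = g + s" using gp by (simp add: field_simps)
      ultimately show ?thesis by simp
    qed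
  qed
  finally show ?thesis by (simp add: s_def)
qed

text \<open>The inclusions of scaled copies of \<open>K\<close> compose, and their ratios multiply.\<close>

lemma funk_dist_triangle:
  assumes x: "x \<in> interior K" and y: "y \<in> interior K" and z: "z \<in> interior K"
  shows "funk_dist x z \<le> funk_dist x y + funk_dist y z"
proof -
  note nn = funk_dist_nonneg[OF x y] funk_dist_nonneg[OF y z]
  have "z + exp (- (funk_dist x y + funk_dist y z)) *\<^sub>R (k - x) \<in> K" if k: "k \<in> K" for k
  proof -
    have "y + exp (- funk_dist x y) *\<^sub>R (k - x) \<in> K"
      using funk_dist_le_iff[OF x y nn(1)] k by simp
    then have "z + exp (- funk_dist y z) *\<^sub>R (y + exp (- funk_dist x y) *\<^sub>R (k - x) - y) \<in> K"
      using funk_dist_le_iff[OF y z nn(2)] by blast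
    then show ?thesis by (simp add: exp_add[symmetric] add.commute)
  qed
  then show ?thesis using funk_dist_le_iff[OF x z] nn by simp
qed

definition homothety :: "'a \<Rightarrow> real \<Rightarrow> 'a \<Rightarrow> 'a" where
  "homothety p t x = p + t *\<^sub>R (x - p)"

lemma homothety_interior:
  assumes p: "p \<in> interior K" and x: "x \<in> interior K" and t: "0 \<le> t" "t \<le> 1"
  shows "homothety p t x \<in> interior K"
proof (cases "t = 1")
  case True
  then show ?thesis using x by (simp add: homothety_def)
next
  case False
  then show ?thesis
    using interior_before_boundary[OF p, of 1 "x - p" t] x t interior_subset
    by (auto simp: homothety_def)
qed

text \<open>The image of \<open>y + s (k - x)\<close> is corrected by the convex combination of \<open>p\<close> and \<open>k\<close> with
  weights \<open>1 - s\<close> and \<open>s\<close>; this realises the inclusion of scaled copies for the image points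
  with the same ratio \<open>s\<close>.\<close>

lemma funk_dist_homothety_le:
  assumes p: "p \<in> interior K" and x: "x \<in> interior K" and y: "y \<in> interior K"
    and t: "0 \<le> t" "t \<le> 1"
  shows "funk_dist (homothety p t x) (homothety p t y) \<le> funk_dist x y"
proof -
  note nn = funk_dist_nonneg[OF x y]
  define s where "s = exp (- funk_dist x y)"
  have s: "0 < s" "s \<le> 1" using nn by (auto simp: s_def)
  have "homothety p t y + s *\<^sub>R (k - homothety p t x) \<in> K" if k: "k \<in> K" for k
  proof -
    have 1: "y + s *\<^sub>R (k - x) \<in> K"
      using funk_dist_le_iff[OF x y nn] k by (simp add: s_def)
    have "p \<in> K" using p interior_subset by blast
    then have 2: "(1 - s) *\<^sub>R p + s *\<^sub>R k \<in> K"
      using convexD[OF convex_K _ k, of p "1 - s" s] s by simp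
    have "t *\<^sub>R (y + s *\<^sub>R (k - x)) + (1 - t) *\<^sub>R ((1 - s) *\<^sub>R p + s *\<^sub>R k) \<in> K"
      using convexD[OF convex_K 1 2, of t "1 - t"] t by simp
    also have "t *\<^sub>R (y + s *\<^sub>R (k - x)) + (1 - t) *\<^sub>R ((1 - s) *\<^sub>R p + s *\<^sub>R k)
        = homothety p t y + s *\<^sub>R (k - homothety p t x)"
      by (simp add: homothety_def algebra_simps)
    finally show ?thesis .
  qed
  then show ?thesis
    using funk_dist_le_iff[OF homothety_interior[OF p x t] homothety_interior[OF p y t] nn]
    by (simp add: s_def)
qed

text \<open>Moving a parameter length \<open>m\<close> in direction \<open>u\<close> shortens the exit time along \<open>u\<close> by \<open>m\<close> and
  lengthens the one along \<open>- u\<close> by \<open>m\<close>; the norms are the reciprocals.\<close>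

lemma funk_norm_along_ray:
  assumes p: "p \<in> interior K" and q: "p + m *\<^sub>R u \<in> interior K" and m: "0 \<le> m"
  shows "funk_norm (p + m *\<^sub>R u) u = funk_norm p u / (1 - m * funk_norm p u)"
    and "funk_norm (p + m *\<^sub>R u) (- u) = funk_norm p (- u) / (1 + m * funk_norm p (- u))"
proof -
  define a b where "a = funk_norm p u" and "b = funk_norm p (- u)"
  have a: "0 \<le> a" "m * a < 1"
    using funk_norm_nonneg[OF p] ray_mem_iff(2)[OF p m, of u] q by (auto simp: a_def)
  have b: "0 \<le> b"
    using funk_norm_nonneg[OF p] by (auto simp: b_def)
  show "funk_norm (p + m *\<^sub>R u) u = funk_norm p u / (1 - m * funk_norm p u)"
    unfolding a_def[symmetric]
  proof (rule nonneg_eq_by_sublevels)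
    fix t :: real assume t: "0 < t"
    have "funk_norm (p + m *\<^sub>R u) u * t \<le> 1 \<longleftrightarrow> p + (m + t) *\<^sub>R u \<in> K"
      using ray_mem_iff(1)[OF q, of t u] t by (simp add: algebra_simps)
    also have "\<dots> \<longleftrightarrow> (m + t) * a \<le> 1"
      using ray_mem_iff(1)[OF p, of "m + t" u] t m by (simp add: a_def)
    also have "\<dots> \<longleftrightarrow> a / (1 - m * a) * t \<le> 1"
      using a by (simp add: field_simps)
    finally show "funk_norm (p + m *\<^sub>R u) u * t \<le> 1 \<longleftrightarrow> a / (1 - m * a) * t \<le> 1" .
  qed (use a funk_norm_nonneg[OF q] in auto)
  have b1: "0 < 1 + m * b" using b m by (simp add: add_pos_nonneg)
  show "funk_norm (p + m *\<^sub>R u) (- u) = funk_norm p (- u) / (1 + m * funk_norm p (- u))"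
    unfolding b_def[symmetric]
  proof (rule nonneg_eq_by_sublevels)
    fix t :: real assume t: "0 < t"
    have "funk_norm (p + m *\<^sub>R u) (- u) * t \<le> 1 \<longleftrightarrow> p + (m - t) *\<^sub>R u \<in> K"
      using ray_mem_iff(1)[OF q, of t "- u"] t by (simp add: algebra_simps)
    also have "\<dots> \<longleftrightarrow> (t - m) * b \<le> 1"
    proof (cases "m \<le> t")
      case True
      then show ?thesis
        using ray_mem_iff(1)[OF p, of "t - m" "- u"] by (simp add: b_def algebra_simps)
    next
      case False
      have "(m - t) * a \<le> m * a" using t a by (intro mult_right_mono) auto
      then have "p + (m - t) *\<^sub>R u \<in> K"
        using ray_mem_iff(1)[OF p, of "m - t" u] False a by (simp add: a_def)
      moreover have "(t - m) * b \<le> 0" using False b by (simp add: mult_nonpos_nonneg)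
      ultimately show ?thesis by auto
    qed
    also have "\<dots> \<longleftrightarrow> b / (1 + m * b) * t \<le> 1"
      using b1 by (simp add: field_simps)
    finally show "funk_norm (p + m *\<^sub>R u) (- u) * t \<le> 1 \<longleftrightarrow> b / (1 + m * b) * t \<le> 1" .
  qed (use b b1 funk_norm_nonneg[OF q] in auto)
qed

lemma funk_dist_along_ray:
  assumes p: "p \<in> interior K" and q: "p + m *\<^sub>R u \<in> interior K" and l: "0 \<le> l" "l \<le> m"
  defines "a \<equiv> funk_norm p u" and "b \<equiv> funk_norm p (- u)"
  shows "funk_dist (p + l *\<^sub>R u) (p + m *\<^sub>R u) = ln (1 - l * a) - ln (1 - m * a)"
    and "funk_dist (p + m *\<^sub>R u) (p + l *\<^sub>R u) = ln (1 + m * b) - ln (1 + l * b)"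
proof -
  have m: "0 \<le> m" using l by simp
  have a: "0 \<le> a" "m * a < 1"
    using funk_norm_nonneg[OF p] ray_mem_iff(2)[OF p m, of u] q by (auto simp: a_def)
  have b: "0 \<le> b" using funk_norm_nonneg[OF p] by (auto simp: b_def)
  have la: "l * a < 1" using a l mult_right_mono[OF l(2) a(1)] by simp
  have ql: "p + l *\<^sub>R u \<in> interior K"
    using ray_mem_iff(2)[OF p l(1), of u] la by (simp add: a_def)
  have b1: "0 < 1 + m * b" "0 < 1 + l * b" using b m l by (simp_all add: add_pos_nonneg)
  have "funk_norm (p + l *\<^sub>R u) (p + m *\<^sub>R u - (p + l *\<^sub>R u)) = (m - l) * (a / (1 - l * a))"
    using funk_norm_scale[OF ql, of "m - l" u] l funk_norm_along_ray(1)[OF p ql l(1)]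
    by (simp add: algebra_simps a_def)
  then have "1 - funk_norm (p + l *\<^sub>R u) (p + m *\<^sub>R u - (p + l *\<^sub>R u))
      = (1 - m * a) / (1 - l * a)"
    using la by (simp add: field_simps)
  then show "funk_dist (p + l *\<^sub>R u) (p + m *\<^sub>R u) = ln (1 - l * a) - ln (1 - m * a)"
    using la a by (simp add: funk_dist_def ln_div)
  have "funk_norm (p + m *\<^sub>R u) (p + l *\<^sub>R u - (p + m *\<^sub>R u)) = (m - l) * (b / (1 + m * b))"
    using funk_norm_scale[OF q, of "m - l" "- u"] l funk_norm_along_ray(2)[OF p q m]
    by (simp add: algebra_simps b_def)
  then have "1 - funk_norm (p + m *\<^sub>R u) (p + l *\<^sub>R u - (p + m *\<^sub>R u))
      = (1 + l * b) / (1 + m * b)"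
    using b1 by (simp add: field_simps)
  then show "funk_dist (p + m *\<^sub>R u) (p + l *\<^sub>R u) = ln (1 + m * b) - ln (1 + l * b)"
    using b1 by (simp add: funk_dist_def ln_div)
qed

lemma exit_point_eq:
  assumes x: "x \<in> interior K" and y: "y \<in> interior K" and ne: "x \<noteq> y"
  shows "exit_point K x y = x + exit_time K x (y - x) *\<^sub>R (y - x)"
    and "1 < exit_time K x (y - x)"
proof -
  define T where "T = exit_time K x (y - x)"
  have T: "0 < T" "x + T *\<^sub>R (y - x) \<in> frontier K"
    unfolding T_def using exit_time_pos exit_time_frontier x ne by auto
  have "1 / T < 1"
    using funk_norm_diff_less_1[OF x y] ne by (simp add: funk_norm_def T_def)
  then have T1: "1 < T" using T by simp
  then show "1 < exit_time K x (y - x)" by (simp add: T_def)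
  show "exit_point K x y = x + exit_time K x (y - x) *\<^sub>R (y - x)"
    unfolding exit_point_def T_def[symmetric]
  proof (rule the_equality)
    have "y = (1 - 1 / T) *\<^sub>R x + (1 / T) *\<^sub>R (x + T *\<^sub>R (y - x))"
      using T1 by (simp add: algebra_simps)
    moreover have "x \<noteq> x + T *\<^sub>R (y - x)" using ne T1 by auto
    ultimately have "y \<in> open_segment x (x + T *\<^sub>R (y - x))"
      unfolding in_segment using T1 by (intro conjI exI[of _ "1 / T"]) auto
    with T show "x + T *\<^sub>R (y - x) \<in> frontier K \<and> y \<in> open_segment x (x + T *\<^sub>R (y - x))"
      by simp
  next
    fix b assume b: "b \<in> frontier K \<and> y \<in> open_segment x b"
    then obtain w where w: "0 < w" "w < 1" "y = (1 - w) *\<^sub>R x + w *\<^sub>R b"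
      by (auto simp: in_segment)
    have "y - x = w *\<^sub>R (b - x)" using w(3) by (simp add: algebra_simps)
    then have "b = x + (1 / w) *\<^sub>R (y - x)" using w(1) by simp
    moreover from this have "exit_time K x (y - x) = 1 / w"
      using exit_time_unique[OF x, of "1 / w" "y - x"] b w by simp
    ultimately show "b = x + T *\<^sub>R (y - x)" by (simp add: T_def)
  qed
qed

text \<open>With \<open>a\<close> and \<open>b\<close> the exit points on the sides of \<open>x\<close> and of \<open>y\<close>, the cross ratio splits
  into \<open>\<bar>x - b\<bar> / \<bar>y - b\<bar>\<close> and \<open>\<bar>y - a\<bar> / \<bar>x - a\<bar>\<close>.\<close>

lemma hilbert_dist_eq:
  assumes x: "x \<in> interior K" and y: "y \<in> interior K"
  shows "hilbert_dist K x y = (funk_dist x y + funk_dist y x) / 2"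
proof (cases "x = y")
  case True
  then show ?thesis by (simp add: hilbert_dist_def funk_dist_def)
next
  case False
  define T S where "T = exit_time K x (y - x)" and "S = exit_time K y (x - y)"
  have T1: "1 < T" and b: "exit_point K x y = x + T *\<^sub>R (y - x)"
    using exit_point_eq[OF x y False] by (auto simp: T_def)
  have S1: "1 < S" and a: "exit_point K y x = y + S *\<^sub>R (x - y)"
    using exit_point_eq[OF y x] False by (auto simp: S_def)
  define D where "D = dist x y"
  have D: "0 < D" using False by (simp add: D_def)
  have "dist (y + S *\<^sub>R (x - y)) y = S * D" "dist (x + T *\<^sub>R (y - x)) x = T * D"
    using T1 S1 by (simp_all add: dist_norm D_def norm_minus_commute)
  moreover have "y + S *\<^sub>R (x - y) - x = (S - 1) *\<^sub>R (x - y)"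
    "x + T *\<^sub>R (y - x) - y = (T - 1) *\<^sub>R (y - x)" by (simp_all add: algebra_simps)
  then have "dist (y + S *\<^sub>R (x - y)) x = (S - 1) * D" "dist (x + T *\<^sub>R (y - x)) y = (T - 1) * D"
    using T1 S1 by (simp_all add: dist_norm D_def norm_minus_commute)
  ultimately have "hilbert_dist K x y = 1 / 2 * ln ((S * D * (T * D)) / ((S - 1) * D * ((T - 1) * D)))"
    using False by (simp add: hilbert_dist_def a b)
  also have "(S * D * (T * D)) / ((S - 1) * D * ((T - 1) * D)) = S / (S - 1) * (T / (T - 1))"
    using D by simp
  also have "ln (S / (S - 1) * (T / (T - 1))) = - ln ((S - 1) / S) - ln ((T - 1) / T)"
    using S1 T1 by (simp add: ln_mult ln_div)
  also have "(S - 1) / S = 1 - funk_norm y (x - y)"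
    using S1 False by (simp add: funk_norm_def S_def diff_divide_distrib)
  also have "(T - 1) / T = 1 - funk_norm x (y - x)"
    using T1 False by (simp add: funk_norm_def T_def diff_divide_distrib)
  finally show ?thesis by (simp add: funk_dist_def)
qed

section \<open>Homotheties and radial projection in the Hilbert distance\<close>

lemma hilbert_dist_self [simp]: "hilbert_dist K x x = 0"
  by (simp add: hilbert_dist_def)

lemma hilbert_dist_sym:
  assumes "x \<in> interior K" "y \<in> interior K"
  shows "hilbert_dist K x y = hilbert_dist K y x"
  using assms by (simp add: hilbert_dist_eq)

lemma hilbert_dist_nonneg:
  assumes "x \<in> interior K" "y \<in> interior K"
  shows "0 \<le> hilbert_dist K x y"
  using assms funk_dist_nonneg by (simp add: hilbert_dist_eq)

lemma hilbert_dist_triangle: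
  assumes "x \<in> interior K" "y \<in> interior K" "z \<in> interior K"
  shows "hilbert_dist K x z \<le> hilbert_dist K x y + hilbert_dist K y z"
  using funk_dist_triangle[OF assms] funk_dist_triangle[OF assms(3,2,1)]
    hilbert_dist_eq[OF assms(1,2)] hilbert_dist_eq[OF assms(2,3)] hilbert_dist_eq[OF assms(1,3)]
  by argo

lemma hilbert_dist_triangle_abs:
  assumes "x \<in> interior K" "y \<in> interior K" "z \<in> interior K"
  shows "\<bar>hilbert_dist K x y - hilbert_dist K x z\<bar> \<le> hilbert_dist K y z"
  using hilbert_dist_triangle[OF assms(1,2,3)] hilbert_dist_triangle[OF assms(1,3,2)]
    hilbert_dist_sym[OF assms(2,3)] by linarith

lemma hilbert_dist_homothety_le:
  assumes "p \<in> interior K" "x \<in> interior K" "y \<in> interior K" "0 \<le> t" "t \<le> 1"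
  shows "hilbert_dist K (homothety p t x) (homothety p t y) \<le> hilbert_dist K x y"
  using funk_dist_homothety_le[OF assms] funk_dist_homothety_le[OF assms(1,3,2,4,5)]
    homothety_interior[OF assms(1,2,4,5)] homothety_interior[OF assms(1,3,4,5)]
  by (simp add: hilbert_dist_eq assms)

lemma hilbert_dist_funk_norm:
  assumes p: "p \<in> interior K" and q: "p + m *\<^sub>R u \<in> interior K" and m: "0 \<le> m"
  shows "hilbert_dist K p (p + m *\<^sub>R u)
    = (ln (1 + m * funk_norm p (- u)) - ln (1 - m * funk_norm p u)) / 2"
  using funk_dist_along_ray[OF p q order_refl m] hilbert_dist_eq[OF p q] by simp

text \<open>Rays from \<open>p\<close> are geodesics: the distances along a ray are differences of the radial
  function.\<close>

lemma hilbert_dist_along_ray: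
  assumes p: "p \<in> interior K" and q: "p + m *\<^sub>R u \<in> interior K" and l: "0 \<le> l" "l \<le> m"
  shows "p + l *\<^sub>R u \<in> interior K"
    and "hilbert_dist K (p + l *\<^sub>R u) (p + m *\<^sub>R u)
      = hilbert_dist K p (p + m *\<^sub>R u) - hilbert_dist K p (p + l *\<^sub>R u)"
proof -
  show ql: "p + l *\<^sub>R u \<in> interior K"
    using interior_before_boundary[OF p _ l(1), of m u] q l interior_subset
    by (cases "l = m") auto
  show "hilbert_dist K (p + l *\<^sub>R u) (p + m *\<^sub>R u)
      = hilbert_dist K p (p + m *\<^sub>R u) - hilbert_dist K p (p + l *\<^sub>R u)"
    using funk_dist_along_ray[OF p q l] hilbert_dist_funk_norm[OF p q]
      hilbert_dist_funk_norm[OF p ql l(1)] l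
    by (simp add: hilbert_dist_eq[OF ql q] field_simps)
qed

lemma homothety_dist_le:
  assumes p: "p \<in> interior K" and x: "x \<in> interior K" and s: "0 \<le> s" "s \<le> 1"
  shows "hilbert_dist K p (homothety p s x) \<le> hilbert_dist K p x"
  using hilbert_dist_along_ray(2)[OF p _ s, of "x - p"] x
    hilbert_dist_nonneg[OF homothety_interior[OF p x s] x]
  by (simp add: homothety_def)

text \<open>Both points are first contracted with the same ratio \<open>s\<close>. The remaining piece lies on the
  ray through \<open>y\<close>, so its length is a difference of distances to \<open>p\<close>, and replacing \<open>y\<close> by \<open>x\<close>
  in it costs another \<open>d x y\<close>. For points on a common sphere, projected to a common sphere, the
  last term vanishes and radial projection is 2-Lipschitz.\<close>

lemma hilbert_dist_homotheties_le:
  assumes p: "p \<in> interior K" and x: "x \<in> interior K" and y: "y \<in> interior K"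
    and s: "0 \<le> s" "s \<le> 1" and t: "0 \<le> t" "t \<le> 1"
  shows "hilbert_dist K (homothety p s x) (homothety p t y)
    \<le> 2 * hilbert_dist K x y
      + \<bar>hilbert_dist K p (homothety p s x) - hilbert_dist K p (homothety p t y)\<bar>"
proof -
  note sx = homothety_interior[OF p x s] and sy = homothety_interior[OF p y s]
    and ty = homothety_interior[OF p y t]
  have ray: "hilbert_dist K (homothety p s y) (homothety p t y)
      = \<bar>hilbert_dist K p (homothety p s y) - hilbert_dist K p (homothety p t y)\<bar>"
  proof (cases "s \<le> t")
    case True
    then show ?thesis
      using hilbert_dist_along_ray(2)[OF p _ s(1) True, of "y - p"] ty hilbert_dist_nonneg[OF sy ty]
      by (simp add: homothety_def)
  next
    case False
    then show ?thesis
      using hilbert_dist_along_ray(2)[OF p _ t(1), of s "y - p"] sy hilbert_dist_nonneg[OF ty sy]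
        hilbert_dist_sym[OF sy ty]
      by (simp add: homothety_def)
  qed
  show ?thesis
    using hilbert_dist_triangle[OF sx sy ty] ray hilbert_dist_homothety_le[OF p x y s]
      hilbert_dist_triangle_abs[OF p sx sy] by linarith
qed

lemma funk_norm_pos:
  assumes "x \<in> interior K" "v \<noteq> 0"
  shows "0 < funk_norm x v"
  using exit_time_pos[OF assms] assms(2) by (simp add: funk_norm_def)

section \<open>Metric spheres seen from their centre\<close>

text \<open>Along a ray the distance to \<open>p\<close> is continuous and tends to infinity at the boundary of
  \<open>K\<close>.\<close>

lemma ray_meets_sphere:
  assumes p: "p \<in> interior K" and u: "u \<noteq> 0" and R: "0 \<le> R"
  obtains m where "0 \<le> m" "p + m *\<^sub>R u \<in> hilbert_sphere K p R"
proof -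
  define a b where "a = funk_norm p u" and "b = funk_norm p (- u)"
  have a: "0 < a" and b: "0 \<le> b"
    using funk_norm_pos[OF p u] funk_norm_nonneg[OF p] by (auto simp: a_def b_def)
  define f where "f m = (ln (1 + m * b) - ln (1 - m * a)) / 2" for m
  \<comment> \<open>at this parameter the term \<open>- ln (1 - m * a) / 2\<close> alone equals \<open>R\<close>\<close>
  define M where "M = (1 - exp (- 2 * R)) / a"
  have M: "0 \<le> M" using R a by (simp add: M_def)
  have Ma: "M * a = 1 - exp (- 2 * R)" using a by (simp add: M_def)
  have less: "m * a < 1" if "0 \<le> m" "m \<le> M" for m
  proof -
    have "m * a \<le> M * a" using that a by (intro mult_right_mono) auto
    also have "\<dots> < 1" by (simp add: Ma)
    finally show ?thesis .
  qed
  have "continuous_on {0..M} f"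
    unfolding f_def using less b
    by (intro continuous_intros) (auto simp: add_nonneg_eq_0_iff intro!: less_imp_neq)
  moreover have "f 0 \<le> R" using R by (simp add: f_def)
  moreover have "R \<le> f M"
    using M b by (simp add: f_def Ma ln_ge_zero)
  ultimately obtain m where m: "0 \<le> m" "m \<le> M" "f m = R"
    using IVT'[of f 0 R M] M by auto
  have q: "p + m *\<^sub>R u \<in> interior K"
    using ray_mem_iff(2)[OF p m(1), of u] less[OF m(1,2)] by (simp add: a_def)
  have "hilbert_dist K p (p + m *\<^sub>R u) = R"
    using hilbert_dist_funk_norm[OF p q m(1)] m(3) by (simp add: f_def a_def b_def)
  with q m that show ?thesis by (auto simp: hilbert_sphere_def)
qed

text \<open>Radial projection towards \<open>p\<close>. The point provided by \<open>ray_meets_sphere\<close> cannot lie beyond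
  \<open>x\<close>, since the distance to \<open>p\<close> is nondecreasing along the ray.\<close>

lemma sphere_shrink:
  assumes p: "p \<in> interior K" and x: "x \<in> hilbert_sphere K p R" and t: "0 \<le> t" "t \<le> R"
  obtains s where "0 \<le> s" "s \<le> 1" "homothety p s x \<in> hilbert_sphere K p t"
proof (cases "x = p \<or> t = R")
  case True
  then have "homothety p 1 x \<in> hilbert_sphere K p t"
    using x t by (auto simp: hilbert_sphere_def homothety_def)
  then show ?thesis using that[of 1] by simp
next
  case False
  then have "x - p \<noteq> 0" by simp
  then obtain m where m: "0 \<le> m" "p + m *\<^sub>R (x - p) \<in> hilbert_sphere K p t"
    using ray_meets_sphere[OF p _ t(1)] by metis
  have "m \<le> 1"
  proof (rule ccontr)
    assume "\<not> m \<le> 1"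
    then have "hilbert_dist K x (p + m *\<^sub>R (x - p)) = t - R"
      using hilbert_dist_along_ray(2)[OF p, of m "x - p" 1] m x by (auto simp: hilbert_sphere_def)
    moreover have "0 \<le> hilbert_dist K x (p + m *\<^sub>R (x - p))"
      using hilbert_dist_nonneg x m by (auto simp: hilbert_sphere_def)
    ultimately show False using False t by simp
  qed
  then show ?thesis using m that[of m] by (simp add: homothety_def)
qed

text \<open>The cones with apex \<open>p\<close> over the points of the sphere fill the ball. For \<open>y\<close> on a smaller
  sphere this also pushes \<open>y\<close> outwards to the sphere of radius \<open>R\<close>.\<close>

lemma ball_point_below_sphere:
  assumes p: "p \<in> interior K" and y: "y \<in> hilbert_ball K p R" and R: "0 \<le> R"
  obtains x s where "x \<in> hilbert_sphere K p R" "0 \<le> s" "s \<le> 1" "y = homothety p s x"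
proof (cases "y = p")
  case True
  \<comment> \<open>the centre itself needs some point of the sphere; any direction will do\<close>
  obtain b :: 'a where "b \<in> Basis" using nonempty_Basis by blast
  then have "b \<noteq> 0" using nonzero_Basis by blast
  then obtain m where "p + m *\<^sub>R b \<in> hilbert_sphere K p R"
    using ray_meets_sphere[OF p _ R] by metis
  then show ?thesis using that[of _ 0] True by (simp add: homothety_def)
next
  case False
  then have u: "y - p \<noteq> 0" by simp
  have yi: "y \<in> interior K" and yR: "hilbert_dist K p y \<le> R"
    using y by (auto simp: hilbert_ball_def)
  obtain m where m: "0 \<le> m" "p + m *\<^sub>R (y - p) \<in> hilbert_sphere K p R"
    using ray_meets_sphere[OF p u R] by metis
  define x where "x = p + m *\<^sub>R (y - p)"
  have x: "x \<in> interior K" "hilbert_dist K p x = R"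
    using m by (auto simp: hilbert_sphere_def x_def)
  show ?thesis
  proof (cases "1 \<le> m")
    case True
    then have y_eq: "y = homothety p (1 / m) x" by (simp add: homothety_def x_def)
    show ?thesis by (rule that[OF _ _ _ y_eq]) (use m True in \<open>auto simp: x_def\<close>)
  next
    case False
    then have "hilbert_dist K x y = hilbert_dist K p y - R"
      using hilbert_dist_along_ray(2)[OF p, of 1 "y - p" m] m(1) yi x by (simp add: x_def)
    then have "hilbert_dist K p y = R" using hilbert_dist_nonneg[OF x(1) yi] yR by simp
    then have "y \<in> hilbert_sphere K p R" using yi by (simp add: hilbert_sphere_def)
    then show ?thesis using that[of y 1] by (simp add: homothety_def)
  qed
qed

section \<open>The volume of small metric balls\<close>

definition unit_tangent_ball :: "'a \<Rightarrow> 'a set" where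
  "unit_tangent_ball x = {v. hilbert_norm K x v \<le> 1}"

text \<open>The sublevel sets are homothetic to translates of the closed set \<open>K\<close>.\<close>

lemma funk_norm_measurable:
  assumes x: "x \<in> interior K"
  shows "funk_norm x \<in> borel_measurable borel"
proof (rule borel_measurableI_le)
  fix a :: real
  consider "0 < a" | "a = 0" | "a < 0" by linarith
  then show "{v \<in> space borel. funk_norm x v \<le> a} \<in> sets borel"
  proof cases
    case 1
    have "closed ((\<lambda>v. x + (1 / a) *\<^sub>R v) -` K)"
      by (intro closed_vimage closed_K continuous_intros)
    moreover have "{v \<in> space borel. funk_norm x v \<le> a} = (\<lambda>v. x + (1 / a) *\<^sub>R v) -` K"
      using funk_norm_le_iff[OF x 1] by auto
    ultimately show ?thesis by simp
  next
    case 2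
    have "{v \<in> space borel. funk_norm x v \<le> a} = {0}"
      using funk_norm_pos[OF x] 2 by (auto dest: leD)
    then show ?thesis by simp
  next
    case 3
    have "{v \<in> space borel. funk_norm x v \<le> a} = {}"
      using less_le_trans[OF 3 funk_norm_nonneg[OF x]] by (auto simp: not_le)
    then show ?thesis by simp
  qed
qed

text \<open>The homothetic copy of \<open>K - x\<close> inside \<open>K - y\<close> bounds the gauge of \<open>K - y\<close>.\<close>

lemma funk_norm_le_exp:
  assumes x: "x \<in> interior K" and y: "y \<in> interior K"
  shows "funk_norm y v \<le> exp (funk_dist x y) * funk_norm x v"
proof (cases "v = 0")
  case False
  define g where "g = funk_norm x v"
  have g: "0 < g" using funk_norm_pos[OF x False] by (simp add: g_def)
  have "x + (1 / g) *\<^sub>R v \<in> K"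
    using funk_norm_le_iff[OF x g, of v] by (simp add: g_def)
  then have "y + exp (- funk_dist x y) *\<^sub>R (x + (1 / g) *\<^sub>R v - x) \<in> K"
    using funk_dist_le_iff[OF x y funk_dist_nonneg[OF x y]] by blast
  then have "y + (exp (- funk_dist x y) / g) *\<^sub>R v \<in> K" by simp
  then have "exp (- funk_dist x y) / g * funk_norm y v \<le> 1"
    using ray_mem_iff(1)[OF y, of "exp (- funk_dist x y) / g" v] g by simp
  then show ?thesis using g by (simp add: g_def exp_minus field_simps)
qed simp

text \<open>Each of the two Funk distances is at most twice the Hilbert distance.\<close>

lemma hilbert_norm_le_exp:
  assumes x: "x \<in> interior K" and y: "y \<in> interior K" and r: "hilbert_dist K x y \<le> r"
  shows "hilbert_norm K y v \<le> exp (2 * r) * hilbert_norm K x v"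
proof -
  have "exp (funk_dist x y) \<le> exp (2 * r)"
    using r funk_dist_nonneg[OF x y] funk_dist_nonneg[OF y x] by (simp add: hilbert_dist_eq x y)
  then have "funk_norm y w \<le> exp (2 * r) * funk_norm x w" for w
    using funk_norm_le_exp[OF x y, of w] mult_right_mono[OF _ funk_norm_nonneg[OF x]] order_trans
    by blast
  from this[of v] this[of "- v"] show ?thesis by (simp add: hilbert_norm_eq algebra_simps)
qed

lemma hilbert_norm_scale:
  assumes x: "x \<in> interior K" and c: "0 \<le> c"
  shows "hilbert_norm K x (c *\<^sub>R v) = c * hilbert_norm K x v"
  using funk_norm_scale[OF x c, of v] funk_norm_scale[OF x c, of "- v"]
  by (simp add: hilbert_norm_eq field_simps)

lemma unit_tangent_ball_borel:
  assumes x: "x \<in> interior K"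
  shows "unit_tangent_ball x \<in> sets borel"
proof -
  note [measurable] = funk_norm_measurable[OF x]
  have "{v \<in> space borel. (funk_norm x v + funk_norm x (- v)) / 2 \<le> 1} \<in> sets borel"
    by measurable
  then show ?thesis by (simp add: unit_tangent_ball_def hilbert_norm_eq)
qed

lemma bounded_unit_tangent_ball:
  assumes x: "x \<in> interior K"
  shows "bounded (unit_tangent_ball x)"
proof (rule bounded_subset)
  have "bounded (((\<lambda>k. 2 *\<^sub>R k) ` ((\<lambda>k. k - x) ` K)))"
    using compact_imp_bounded[OF compact_K] by (intro bounded_scaling bounded_translation_minus)
  then show "bounded ((\<lambda>k. 2 *\<^sub>R (k - x)) ` K)" by (simp add: image_image)
  show "unit_tangent_ball x \<subseteq> (\<lambda>k. 2 *\<^sub>R (k - x)) ` K"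
  proof
    fix v assume "v \<in> unit_tangent_ball x"
    then have "funk_norm x v \<le> 2"
      using funk_norm_nonneg[OF x, of "- v"] by (simp add: unit_tangent_ball_def hilbert_norm_eq)
    then have "x + (1 / 2) *\<^sub>R v \<in> K" using funk_norm_le_iff[OF x, of 2 v] by simp
    then show "v \<in> (\<lambda>k. 2 *\<^sub>R (k - x)) ` K" by (rule rev_image_eqI) simp
  qed
qed

lemma funk_norm_le_norm:
  assumes x: "x \<in> interior K"
  obtains e where "0 < e" "\<And>v. funk_norm x v \<le> norm v / e"
proof -
  obtain e where e: "0 < e" "cball x e \<subseteq> K"
    using x mem_interior_cball by blast
  have "funk_norm x v \<le> norm v / e" for v
  proof (cases "v = 0")
    case False
    then have "x + (e / norm v) *\<^sub>R v \<in> K" using e by (intro subsetD[OF e(2)]) (auto simp: dist_norm)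
    then have "e / norm v * funk_norm x v \<le> 1"
      using ray_mem_iff(1)[OF x, of "e / norm v" v] e by simp
    then show ?thesis using False e by (simp add: field_simps)
  qed simp
  with e that show ?thesis by blast
qed

lemma measure_unit_tangent_ball_pos:
  assumes x: "x \<in> interior K"
  shows "0 < measure lborel (unit_tangent_ball x)"
proof -
  obtain e where e: "0 < e" "\<And>v. funk_norm x v \<le> norm v / e"
    using funk_norm_le_norm[OF x] by blast
  have "ball 0 e \<subseteq> unit_tangent_ball x"
  proof
    fix v :: 'a assume "v \<in> ball 0 e"
    then have "norm v / e \<le> 1" using e by simp
    then show "v \<in> unit_tangent_ball x"
      using e(2)[of v] e(2)[of "- v"] by (simp add: unit_tangent_ball_def hilbert_norm_eq)
  qed
  then have "measure lborel (ball (0::'a) e) \<le> measure lborel (unit_tangent_ball x)"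
    using unit_tangent_ball_borel[OF x] emeasure_bounded_finite[OF bounded_unit_tangent_ball[OF x]]
    by (intro measure_mono_fmeasurable) (auto simp: fmeasurable_def)
  then show ?thesis using content_ball_pos[OF e(1), of "0::'a"] by linarith
qed

lemma busemann_density_pos:
  assumes "x \<in> interior K"
  shows "0 < busemann_density K x"
  using measure_unit_tangent_ball_pos[OF assms]
  by (simp add: busemann_density_def unit_tangent_ball_def[symmetric])

text \<open>The unit tangent ball at \<open>y\<close> contains the one at \<open>x\<close> scaled by \<open>exp (- 2 r)\<close>.\<close>

lemma busemann_density_le_exp:
  assumes x: "x \<in> interior K" and y: "y \<in> interior K" and r: "hilbert_dist K x y \<le> r"
  shows "busemann_density K y \<le> exp (2 * r * DIM('a)) * busemann_density K x"
proof -
  define c where "c = exp (- 2 * r)"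
  have c: "0 < c" by (simp add: c_def)
  have "(\<lambda>v. c *\<^sub>R v + 0) ` unit_tangent_ball x \<subseteq> unit_tangent_ball y"
  proof clarify
    fix v assume "v \<in> unit_tangent_ball x"
    then have "hilbert_norm K x v \<le> 1" by (simp add: unit_tangent_ball_def)
    then have "exp (2 * r) * hilbert_norm K x v \<le> exp (2 * r)" by simp
    then have "hilbert_norm K y v \<le> exp (2 * r)" using hilbert_norm_le_exp[OF x y r, of v] by linarith
    then have "c * hilbert_norm K y v \<le> 1" by (simp add: c_def exp_minus field_simps)
    then show "c *\<^sub>R v + 0 \<in> unit_tangent_ball y"
      using hilbert_norm_scale[OF y, of c v] c by (simp add: unit_tangent_ball_def)
  qed
  then have "measure lborel ((\<lambda>v. c *\<^sub>R v + 0) ` unit_tangent_ball x) \<le> measure lborel (unit_tangent_ball y)"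
    using affine_image_borel[of c "unit_tangent_ball x" 0] c unit_tangent_ball_borel[OF x] unit_tangent_ball_borel[OF y]
      emeasure_bounded_finite[OF bounded_unit_tangent_ball[OF y]]
    by (intro measure_mono_fmeasurable) (auto simp: fmeasurable_def)
  then have le: "c ^ DIM('a) * measure lborel (unit_tangent_ball x) \<le> measure lborel (unit_tangent_ball y)"
    using measure_affine_image[OF c unit_tangent_ball_borel[OF x], of 0] by simp
  have cn: "c ^ DIM('a) * exp (2 * r * DIM('a)) = 1"
    by (simp add: c_def exp_of_nat_mult[symmetric] exp_add[symmetric] mult_ac)
  note pos = measure_unit_tangent_ball_pos[OF x] measure_unit_tangent_ball_pos[OF y]
  have "busemann_density K y \<le> unit_ball_vol DIM('a) / (c ^ DIM('a) * measure lborel (unit_tangent_ball x))"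
    unfolding busemann_density_def unit_tangent_ball_def[symmetric]
    using le pos c by (intro divide_left_mono) auto
  also have "\<dots> = exp (2 * r * DIM('a)) * busemann_density K x"
    unfolding busemann_density_def unit_tangent_ball_def[symmetric]
    using cn pos c by (simp add: field_simps)
  finally show ?thesis .
qed

lemma hilbert_dist_alt:
  assumes x: "x \<in> interior K" and y: "y \<in> interior K"
  shows "hilbert_dist K x y = (ln (1 + funk_norm x (x - y)) - ln (1 - funk_norm x (y - x))) / 2"
  using hilbert_dist_funk_norm[OF x, of 1 "y - x"] y by simp

lemma hilbert_dist_tendsto_0:
  assumes x: "x \<in> interior K"
  shows "((\<lambda>y. hilbert_dist K x y) \<longlongrightarrow> 0) (at x)"
proof -
  obtain e where e: "0 < e" "\<And>v. funk_norm x v \<le> norm v / e"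
    using funk_norm_le_norm[OF x] by blast
  have lim: "((\<lambda>y. norm (y - x) / e) \<longlongrightarrow> 0) (at x)"
    using e by (auto intro!: tendsto_eq_intros)
  have g1: "((\<lambda>y. funk_norm x (y - x)) \<longlongrightarrow> 0) (at x)"
    by (rule tendsto_sandwich[OF _ _ tendsto_const lim])
      (use e funk_norm_nonneg[OF x] in \<open>auto intro!: always_eventually\<close>)
  have "funk_norm x (x - y) \<le> norm (y - x) / e" for y
    using e(2)[of "x - y"] by (simp add: norm_minus_commute)
  then have g2: "((\<lambda>y. funk_norm x (x - y)) \<longlongrightarrow> 0) (at x)"
    by (intro tendsto_sandwich[OF _ _ tendsto_const lim] always_eventually allI funk_norm_nonneg[OF x])
  have "((\<lambda>y. (ln (1 + funk_norm x (x - y)) - ln (1 - funk_norm x (y - x))) / 2) \<longlongrightarrow> 0) (at x)"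
    by (auto intro!: tendsto_eq_intros g1 g2)
  moreover have "\<forall>\<^sub>F y in at x. y \<in> interior K"
    using x by (intro eventually_at_in_open') auto
  then have "\<forall>\<^sub>F y in at x. (ln (1 + funk_norm x (x - y)) - ln (1 - funk_norm x (y - x))) / 2
      = hilbert_dist K x y"
    by eventually_elim (use hilbert_dist_alt[OF x] in simp)
  ultimately show ?thesis by (rule Lim_transform_eventually)
qed

text \<open>The Harnack-type inequality \<open>busemann_density_le_exp\<close> squeezes the density at nearby
  points.\<close>

lemma continuous_busemann_density: "continuous_on (interior K) (busemann_density K)"
proof (rule continuous_at_imp_continuous_on, rule ballI)
  fix x assume x: "x \<in> interior K"
  define f where "f y = 2 * hilbert_dist K x y * DIM('a)" for y
  have f: "(f \<longlongrightarrow> 0) (at x)"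
    unfolding f_def using hilbert_dist_tendsto_0[OF x] by (auto intro!: tendsto_eq_intros)
  have ev: "\<forall>\<^sub>F y in at x. y \<in> interior K"
    using x by (intro eventually_at_in_open') auto
  have "(busemann_density K \<longlongrightarrow> busemann_density K x) (at x)"
  proof (rule tendsto_sandwich)
    show "((\<lambda>y. exp (- f y) * busemann_density K x) \<longlongrightarrow> busemann_density K x) (at x)"
      "((\<lambda>y. exp (f y) * busemann_density K x) \<longlongrightarrow> busemann_density K x) (at x)"
      by (auto intro!: tendsto_eq_intros f)
    show "\<forall>\<^sub>F y in at x. exp (- f y) * busemann_density K x \<le> busemann_density K y"
      using ev
    proof eventually_elim
      case (elim y)
      have "busemann_density K x \<le> exp (f y) * busemann_density K y"
        using busemann_density_le_exp[OF elim x order_refl] hilbert_dist_sym[OF x elim]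
        by (simp add: f_def)
      then show ?case by (simp add: exp_minus field_simps)
    qed
    show "\<forall>\<^sub>F y in at x. busemann_density K y \<le> exp (f y) * busemann_density K x"
      using ev by eventually_elim (use busemann_density_le_exp[OF x _ order_refl] in \<open>simp add: f_def\<close>)
  qed
  then show "isCont (busemann_density K) x" by (simp add: isCont_def)
qed

text \<open>A measure that agrees with \<open>busemann_vol\<close> on Borel subsets of the interior of \<open>K\<close>, so that
  countable subadditivity and additivity over disjoint sets are available. The density is cut
  off outside the interior, where the exit times behind it are meaningless.\<close>

definition hilbert_vol :: "'a measure" where
  "hilbert_vol = density lborel (\<lambda>x. ennreal (indicator (interior K) x * busemann_density K x))"

lemma hilbert_vol_density_measurable [measurable]:
  "(\<lambda>x. indicator (interior K) x * busemann_density K x) \<in> borel_measurable borel"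
  using borel_measurable_continuous_on_indicator[OF _ continuous_busemann_density] by simp

lemma sets_hilbert_vol [simp]: "sets hilbert_vol = sets borel"
  by (simp add: hilbert_vol_def)

lemma busemann_vol_eq:
  assumes "A \<in> sets borel" "A \<subseteq> interior K"
  shows "busemann_vol K A = emeasure hilbert_vol A"
proof -
  have "(\<lambda>x. ennreal (indicator (interior K) x * busemann_density K x)) \<in> borel_measurable lborel"
    using hilbert_vol_density_measurable by simp
  from emeasure_density[OF this, of A] assms show ?thesis
    unfolding busemann_vol_def hilbert_vol_def
    by (auto intro!: nn_integral_cong simp: indicator_def)
qed

lemma emeasure_hilbert_vol:
  assumes "A \<in> sets borel" "A \<subseteq> interior K"
  shows "emeasure hilbert_vol A = (\<integral>\<^sup>+x\<in>A. ennreal (busemann_density K x) \<partial>lborel)"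
  using busemann_vol_eq[OF assms] by (simp add: busemann_vol_def)

lemma hilbert_ball_borel:
  assumes x: "x \<in> interior K"
  shows "hilbert_ball K x r \<in> sets borel"
proof -
  note [measurable] = funk_norm_measurable[OF x]
  have "{y \<in> space borel. (ln (1 + funk_norm x (x - y)) - ln (1 - funk_norm x (y - x))) / 2 \<le> r}
      \<in> sets borel" by measurable
  moreover have "hilbert_ball K x r = interior K \<inter>
      {y \<in> space borel. (ln (1 + funk_norm x (x - y)) - ln (1 - funk_norm x (y - x))) / 2 \<le> r}"
    by (auto simp: hilbert_ball_def hilbert_dist_alt[OF x])
  ultimately show ?thesis by simp
qed

lemma hilbert_ball_subset_interior: "hilbert_ball K x r \<subseteq> interior K"
  by (auto simp: hilbert_ball_def)

lemma emeasure_hilbert_vol_bounds: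
  assumes x: "x \<in> interior K" and A: "A \<in> sets borel" "A \<subseteq> hilbert_ball K x r" and fin: "bounded A"
  shows "emeasure hilbert_vol A \<le> ennreal (exp (2 * r * DIM('a)) * busemann_density K x * measure lborel A)"
    and "ennreal (exp (- 2 * r * DIM('a)) * busemann_density K x * measure lborel A) \<le> emeasure hilbert_vol A"
proof -
  have Ai: "A \<subseteq> interior K" using A hilbert_ball_subset_interior by blast
  have em: "emeasure lborel A = ennreal (measure lborel A)"
    using emeasure_bounded_finite[OF fin] by (simp add: emeasure_eq_ennreal_measure)
  have const: "(\<integral>\<^sup>+y\<in>A. ennreal c \<partial>lborel) = ennreal (c * measure lborel A)" if "0 \<le> c" for c
    using A that by (simp add: nn_integral_cmult_indicator em ennreal_mult)
  have upper: "busemann_density K y \<le> exp (2 * r * DIM('a)) * busemann_density K x" if "y \<in> A" for y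
    using busemann_density_le_exp[OF x, of y r] that A by (auto simp: hilbert_ball_def)
  have lower: "exp (- 2 * r * DIM('a)) * busemann_density K x \<le> busemann_density K y" if "y \<in> A" for y
  proof -
    have "y \<in> interior K" "hilbert_dist K y x \<le> r"
      using that A x hilbert_dist_sym by (auto simp: hilbert_ball_def)
    then have "busemann_density K x \<le> exp (2 * r * DIM('a)) * busemann_density K y"
      using busemann_density_le_exp[OF _ x, of y r] by blast
    then show ?thesis by (simp add: exp_minus field_simps)
  qed
  note d = busemann_density_pos[OF x]
  show "emeasure hilbert_vol A \<le> ennreal (exp (2 * r * DIM('a)) * busemann_density K x * measure lborel A)"
    unfolding emeasure_hilbert_vol[OF A(1) Ai] using d
    by (subst const[symmetric]) (auto intro!: nn_integral_mono ennreal_leI upper simp: indicator_def)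
  show "ennreal (exp (- 2 * r * DIM('a)) * busemann_density K x * measure lborel A) \<le> emeasure hilbert_vol A"
    unfolding emeasure_hilbert_vol[OF A(1) Ai] using d lower
    by (subst const[symmetric]) (auto intro!: nn_integral_mono ennreal_leI simp: indicator_def)
qed

text \<open>Both terms of \<open>2 d x y = - ln (1 - g) + ln (1 + h)\<close> with \<open>g = funk_norm x (y - x)\<close> and
  \<open>h = funk_norm x (x - y)\<close> are nonnegative, so each is at most \<open>2 r\<close>; hence \<open>g \<le> 2 r\<close> and, for
  \<open>r \<le> 1/2\<close>, \<open>h \<le> exp (2 r) - 1 \<le> 4 r\<close>.\<close>

lemma hilbert_ball_subset_tangent_ball:
  assumes x: "x \<in> interior K" and r: "0 < r" "r \<le> 1 / 2"
  shows "hilbert_ball K x r \<subseteq> (\<lambda>v. (3 * r) *\<^sub>R v + x) ` unit_tangent_ball x"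
proof
  fix y assume y: "y \<in> hilbert_ball K x r"
  then have yi: "y \<in> interior K" by (simp add: hilbert_ball_def)
  define g h where "g = funk_norm x (y - x)" and "h = funk_norm x (x - y)"
  have g: "0 \<le> g" "g < 1" and h: "0 \<le> h"
    using funk_norm_nonneg[OF x] funk_norm_diff_less_1[OF x yi] by (auto simp: g_def h_def)
  have le: "ln (1 + h) - ln (1 - g) \<le> 2 * r"
    using y hilbert_dist_alt[OF x yi] by (simp add: hilbert_ball_def g_def h_def)
  have "ln (1 - g) \<le> - g" using ln_le_minus_one[of "1 - g"] g by simp
  then have "g \<le> 2 * r" using le ln_ge_zero[of "1 + h"] h by linarith
  moreover have "h \<le> 4 * r"
  proof -
    have "ln (1 + h) \<le> 2 * r" using le ln_le_zero_iff[of "1 - g"] g by linarith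
    then have "1 + h \<le> exp (2 * r)" using h by (metis exp_ln exp_le_cancel_iff add_pos_nonneg zero_less_one)
    also have "\<dots> \<le> 1 + 2 * r + (2 * r)\<^sup>2" using exp_bound[of "2 * r"] r by simp
    also have "(2 * r)\<^sup>2 \<le> 2 * r" using r by (simp add: power2_eq_square)
    finally show ?thesis by simp
  qed
  ultimately have "hilbert_norm K x (y - x) \<le> 3 * r" by (simp add: hilbert_norm_eq g_def h_def)
  then have "1 / (3 * r) * hilbert_norm K x (y - x) \<le> 1" using r by (simp add: field_simps)
  then have "hilbert_norm K x ((1 / (3 * r)) *\<^sub>R (y - x)) \<le> 1"
    using hilbert_norm_scale[OF x, of "1 / (3 * r)" "y - x"] r by simp
  then have "(1 / (3 * r)) *\<^sub>R (y - x) \<in> unit_tangent_ball x" by (simp add: unit_tangent_ball_def)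
  then show "y \<in> (\<lambda>v. (3 * r) *\<^sub>R v + x) ` unit_tangent_ball x"
    by (rule rev_image_eqI) (use r in simp)
qed

text \<open>With \<open>g\<close> and \<open>h\<close> as in the reverse inclusion, the definition of the tangent ball gives
  \<open>g, h \<le> r / 2\<close>; then \<open>- ln (1 - g) \<le> 2 g\<close> and \<open>ln (1 + h) \<le> h\<close> bound \<open>2 d x y\<close> by \<open>2 r\<close>.\<close>

lemma tangent_ball_subset_hilbert_ball:
  assumes x: "x \<in> interior K" and r: "0 < r" "r \<le> 1"
  shows "(\<lambda>v. (r / 4) *\<^sub>R v + x) ` unit_tangent_ball x \<subseteq> hilbert_ball K x r"
proof clarify
  fix v assume "v \<in> unit_tangent_ball x"
  then have v: "funk_norm x v \<le> 2" "funk_norm x (- v) \<le> 2"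
    using funk_norm_nonneg[OF x, of v] funk_norm_nonneg[OF x, of "- v"]
    by (auto simp: unit_tangent_ball_def hilbert_norm_eq)
  define g h where "g = r / 4 * funk_norm x v" and "h = r / 4 * funk_norm x (- v)"
  have g: "0 \<le> g" "g \<le> r / 2" and h: "0 \<le> h" "h \<le> r / 2"
    using v r funk_norm_nonneg[OF x] mult_left_mono[OF v(1), of "r / 4"] mult_left_mono[OF v(2), of "r / 4"]
    by (auto simp: g_def h_def)
  have q: "x + (r / 4) *\<^sub>R v \<in> interior K"
  proof -
    have "0 \<le> r / 4" "g < 1" using g r by auto
    then show ?thesis using ray_mem_iff(2)[OF x, of "r / 4" v] unfolding g_def by blast
  qed
  have "hilbert_dist K x (x + (r / 4) *\<^sub>R v) = (ln (1 + h) - ln (1 - g)) / 2"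
    using hilbert_dist_funk_norm[OF x q] r by (simp add: g_def h_def)
  also have "\<dots> \<le> r"
  proof -
    have "ln (1 + h) \<le> h" using h ln_add_one_self_le_self by simp
    moreover have "- g - 2 * g\<^sup>2 \<le> ln (1 - g)" using g r by (intro ln_one_minus_pos_lower_bound) auto
    moreover have "2 * g\<^sup>2 \<le> g" using g r mult_right_mono[of "2 * g" 1 g] by (simp add: power2_eq_square)
    ultimately have "ln (1 + h) - ln (1 - g) \<le> 2 * r" using g h r by linarith
    then show ?thesis by simp
  qed
  finally show "(r / 4) *\<^sub>R v + x \<in> hilbert_ball K x r"
    using q by (simp add: hilbert_ball_def add.commute)
qed

text \<open>The density at \<open>x\<close> times the Lebesgue measure of the unit tangent ball at \<open>x\<close> is the
  constant \<open>unit_ball_vol n\<close>, which removes every dependence on \<open>x\<close> and \<open>K\<close>.\<close>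

lemma emeasure_small_ball_le:
  assumes x: "x \<in> interior K" and r: "0 < r" "r \<le> 1 / 2"
  shows "emeasure hilbert_vol (hilbert_ball K x r)
    \<le> ennreal (exp DIM('a) * unit_ball_vol DIM('a) * 3 ^ DIM('a) * r ^ DIM('a))"
proof -
  let ?T = "unit_tangent_ball x" and ?B = "hilbert_ball K x r"
  note pos = measure_unit_tangent_ball_pos[OF x] and T = unit_tangent_ball_borel[OF x]
  have im: "(\<lambda>v. (3 * r) *\<^sub>R v + x) ` ?T \<in> sets borel"
    using affine_image_borel[OF _ T, of "3 * r"] r by simp
  have bK: "bounded ?B" "bounded (interior K)"
    using compact_imp_bounded[OF compact_K] bounded_subset interior_subset hilbert_ball_subset_interior
    by (meson order_trans)+
  have "bounded ((\<lambda>v. v + x) ` ((\<lambda>v. (3 * r) *\<^sub>R v) ` ?T))"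
    using bounded_translation[OF bounded_scaling[OF bounded_unit_tangent_ball[OF x], of "3 * r"], of x]
    by (simp add: add.commute)
  then have bim: "bounded ((\<lambda>v. (3 * r) *\<^sub>R v + x) ` ?T)" by (simp add: image_image)
  have "measure lborel ?B \<le> measure lborel ((\<lambda>v. (3 * r) *\<^sub>R v + x) ` ?T)"
    using hilbert_ball_subset_tangent_ball[OF x r] hilbert_ball_borel[OF x] im emeasure_bounded_finite[OF bim]
    by (intro measure_mono_fmeasurable) (auto simp: fmeasurable_def)
  also have "\<dots> = (3 * r) ^ DIM('a) * measure lborel ?T"
    using r by (intro measure_affine_image T) auto
  finally have "busemann_density K x * measure lborel ?B
      \<le> busemann_density K x * ((3 * r) ^ DIM('a) * measure lborel ?T)"
    using busemann_density_pos[OF x] by (intro mult_left_mono) auto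
  also have "\<dots> = unit_ball_vol DIM('a) * 3 ^ DIM('a) * r ^ DIM('a)"
    using pos by (simp add: busemann_density_def unit_tangent_ball_def[symmetric] power_mult_distrib)
  finally have *: "busemann_density K x * measure lborel ?B
      \<le> unit_ball_vol DIM('a) * 3 ^ DIM('a) * r ^ DIM('a)" .
  have "exp (2 * r * DIM('a)) * (busemann_density K x * measure lborel ?B)
      \<le> exp DIM('a) * (unit_ball_vol DIM('a) * 3 ^ DIM('a) * r ^ DIM('a))"
    by (rule mult_mono[OF _ *]) (use r busemann_density_pos[OF x] in auto)
  moreover have "emeasure hilbert_vol ?B \<le> ennreal (exp (2 * r * DIM('a)) * (busemann_density K x * measure lborel ?B))"
    unfolding mult.assoc[symmetric]
    using bK by (intro emeasure_hilbert_vol_bounds x hilbert_ball_borel) auto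
  ultimately have "emeasure hilbert_vol ?B
      \<le> ennreal (exp DIM('a) * (unit_ball_vol DIM('a) * 3 ^ DIM('a) * r ^ DIM('a)))"
    by (meson ennreal_leI order_trans)
  then show ?thesis by (simp add: mult.assoc)
qed

lemma emeasure_small_ball_ge:
  assumes x: "x \<in> interior K" and r: "0 < r" "r \<le> 1 / 2"
  shows "ennreal (exp (- DIM('a)) * unit_ball_vol DIM('a) / 4 ^ DIM('a) * r ^ DIM('a))
    \<le> emeasure hilbert_vol (hilbert_ball K x r)"
proof -
  let ?T = "unit_tangent_ball x" and ?B = "hilbert_ball K x r"
  let ?A = "(\<lambda>v. (r / 4) *\<^sub>R v + x) ` ?T"
  note pos = measure_unit_tangent_ball_pos[OF x] and T = unit_tangent_ball_borel[OF x]
  have im: "?A \<in> sets borel" using affine_image_borel[OF _ T, of "r / 4"] r by simp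
  have sub: "?A \<subseteq> ?B" using r by (intro tangent_ball_subset_hilbert_ball x) auto
  have bA: "bounded ?A"
    using compact_imp_bounded[OF compact_K] bounded_subset interior_subset hilbert_ball_subset_interior sub
    by (meson order_trans)
  have "measure lborel ?A = (r / 4) ^ DIM('a) * measure lborel ?T"
    using r by (intro measure_affine_image T) auto
  then have "busemann_density K x * measure lborel ?A = unit_ball_vol DIM('a) / 4 ^ DIM('a) * r ^ DIM('a)"
    using pos by (simp add: busemann_density_def unit_tangent_ball_def[symmetric] power_divide)
  then have "ennreal (exp (- DIM('a)) * unit_ball_vol DIM('a) / 4 ^ DIM('a) * r ^ DIM('a))
      = ennreal (exp (- DIM('a)) * (busemann_density K x * measure lborel ?A))"
    by (simp add: mult.assoc)
  also have "\<dots> \<le> ennreal (exp (- 2 * r * DIM('a)) * (busemann_density K x * measure lborel ?A))"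
    using r busemann_density_pos[OF x] by (intro ennreal_leI mult_right_mono) auto
  also have "\<dots> \<le> emeasure hilbert_vol ?A"
    using emeasure_hilbert_vol_bounds(2)[OF x im sub bA] by (simp add: mult.assoc)
  also have "\<dots> \<le> emeasure hilbert_vol ?B"
    using sub hilbert_ball_borel[OF x] by (intro emeasure_mono) auto
  finally show ?thesis .
qed

text \<open>The density on the ball is at most \<open>exp (2 n r)\<close> times the density at the centre, and the
  ball lies in the bounded set \<open>K\<close>.\<close>

lemma emeasure_ball_le_exp:
  assumes p: "p \<in> interior K"
  shows "emeasure hilbert_vol (hilbert_ball K p r)
    \<le> ennreal (exp (2 * r * DIM('a)) * (busemann_density K p * measure lborel K))"
proof -
  let ?B = "hilbert_ball K p r"
  have KL: "emeasure lborel K < \<infinity>"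
    using emeasure_bounded_finite compact_imp_bounded compact_K by blast
  have sub: "?B \<subseteq> K" using hilbert_ball_subset_interior interior_subset by blast
  have "emeasure hilbert_vol ?B \<le> ennreal (exp (2 * r * DIM('a)) * busemann_density K p * measure lborel ?B)"
    using bounded_subset[OF compact_imp_bounded[OF compact_K] sub]
    by (intro emeasure_hilbert_vol_bounds p hilbert_ball_borel) auto
  also have "\<dots> \<le> ennreal (exp (2 * r * DIM('a)) * busemann_density K p * measure lborel K)"
    using sub hilbert_ball_borel[OF p] KL borel_closed[OF closed_K] busemann_density_pos[OF p]
    by (intro ennreal_leI mult_left_mono measure_mono_fmeasurable) (auto simp: fmeasurable_def)
  finally show ?thesis by (simp add: mult.assoc)
qed

lemma emeasure_ball_finite:
  assumes "p \<in> interior K"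
  shows "emeasure hilbert_vol (hilbert_ball K p r) < \<infinity>"
  using emeasure_ball_le_exp[OF assms] by (metis ennreal_less_top infinity_ennreal_def le_less_trans)

section \<open>The volume of a ball is bounded by the area of its sphere\<close>

text \<open>Fix \<open>e \<in> E\<close> on the sphere and let \<open>q\<^sub>j\<close> be the point at distance \<open>j \<eta>\<close> from \<open>p\<close> on the
  segment from \<open>p\<close> to \<open>e\<close>. The distance of a point of the cone from \<open>p\<close> differs by at most \<open>\<eta>\<close>
  from some level \<open>j \<eta>\<close>; the point is then within \<open>2 \<eta> + \<eta>\<close> of \<open>q\<^sub>j\<close>, so that the balls of
  radius \<open>3 \<eta>\<close> about the \<open>q\<^sub>j\<close> cover the cone. The bound \<open>1/6\<close> keeps \<open>3 \<eta>\<close> in the range of the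
  volume estimate for small balls; in the constant, \<open>9\<close> is the factor \<open>3\<close> of that estimate times
  the \<open>3\<close> of \<open>3 \<eta>\<close>.\<close>

lemma small_cone_cover:
  assumes p: "p \<in> interior K" and R: "0 \<le> R" and E: "E \<subseteq> interior K"
    and \<eta>: "0 < \<eta>" "\<eta> \<le> 1 / 6"
    and small: "\<And>x y. x \<in> E \<Longrightarrow> y \<in> E \<Longrightarrow> hilbert_dist K x y \<le> \<eta>"
  defines "C \<equiv> exp DIM('a) * unit_ball_vol DIM('a) * 9 ^ DIM('a)"
  shows "\<exists>A \<in> sets borel.
    {homothety p s x | s x. 0 \<le> s \<and> s \<le> 1 \<and> x \<in> E \<inter> hilbert_sphere K p R} \<subseteq> A \<and>
    emeasure hilbert_vol A \<le> ennreal (C * (R + 1) * \<eta> ^ (DIM('a) - 1))"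
    (is "\<exists>A \<in> sets borel. ?cone \<subseteq> A \<and> _")
proof -
  define B where "B = exp DIM('a) * unit_ball_vol DIM('a) * 3 ^ DIM('a)"
  have B: "0 < B" by (simp add: B_def)
  have "(9::real) ^ DIM('a) = 3 ^ DIM('a) * 3 ^ DIM('a)" by (simp flip: power_mult_distrib)
  then have C_eq: "C = B * 3 ^ DIM('a)" by (simp add: C_def B_def)
  show ?thesis
  proof (cases "E \<inter> hilbert_sphere K p R = {}")
    case True
    then have "?cone = {}" by blast
    then show ?thesis by (intro bexI[of _ "{}"]) auto
  next
    case False
    then obtain e where e: "e \<in> E" "e \<in> hilbert_sphere K p R" by blast
    then have ei: "e \<in> interior K" using E by blast
    define N where "N = nat \<lfloor>R / \<eta>\<rfloor>"
    have N: "real N * \<eta> \<le> R"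
    proof -
      have "real N = of_int \<lfloor>R / \<eta>\<rfloor>" using R \<eta> by (simp add: N_def)
      then have "real N \<le> R / \<eta>" by linarith
      then show ?thesis using \<eta> by (simp add: field_simps)
    qed
    have level: "real j * \<eta> \<le> R" if "j \<le> N" for j
    proof -
      have "real j * \<eta> \<le> real N * \<eta>" using that \<eta> by (intro mult_right_mono) auto
      then show ?thesis using N by linarith
    qed
    have "\<exists>s. 0 \<le> s \<and> s \<le> 1 \<and> homothety p s e \<in> hilbert_sphere K p (real j * \<eta>)" if "j \<le> N" for j
      using sphere_shrink[OF p e(2), of "real j * \<eta>"] level[OF that] \<eta> by (metis mult_nonneg_nonneg less_imp_le of_nat_0_le_iff)
    then obtain s where s: "\<And>j. j \<le> N \<Longrightarrow> 0 \<le> s j \<and> s j \<le> 1 \<and> homothety p (s j) e \<in> hilbert_sphere K p (real j * \<eta>)"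
      by metis
    define q where "q j = homothety p (s j) e" for j
    have q: "q j \<in> interior K" "hilbert_dist K p (q j) = real j * \<eta>" if "j \<le> N" for j
      using s[OF that] by (auto simp: q_def hilbert_sphere_def)
    define A where "A = (\<Union>j\<le>N. hilbert_ball K (q j) (3 * \<eta>))"
    have "?cone \<subseteq> A"
    proof clarify
      fix t :: real and x assume t: "0 \<le> t" "t \<le> 1" and x: "x \<in> E" "x \<in> hilbert_sphere K p R"
      have xi: "x \<in> interior K" using x E by blast
      define y where "y = homothety p t x"
      have yi: "y \<in> interior K" unfolding y_def by (rule homothety_interior[OF p xi t])
      define d where "d = hilbert_dist K p y"
      have d: "0 \<le> d" "d \<le> R"
        using hilbert_dist_nonneg[OF p yi] homothety_dist_le[OF p xi t] x
        by (auto simp: d_def y_def hilbert_sphere_def)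
      define j where "j = nat \<lfloor>d / \<eta>\<rfloor>"
      have "d / \<eta> \<le> R / \<eta>" using d \<eta> by (intro divide_right_mono) auto
      then have jN: "j \<le> N" unfolding j_def N_def by (intro nat_mono floor_mono)
      have "real j = of_int \<lfloor>d / \<eta>\<rfloor>" using d \<eta> by (simp add: j_def)
      then have "real j \<le> d / \<eta>" "d / \<eta> < real j + 1" by linarith+
      then have "real j * \<eta> \<le> d" "d < real j * \<eta> + \<eta>" using \<eta> by (simp_all add: field_simps)
      then have "\<bar>real j * \<eta> - d\<bar> \<le> \<eta>" by linarith
      moreover have "hilbert_dist K (q j) y \<le> 2 * hilbert_dist K e x + \<bar>hilbert_dist K p (q j) - d\<bar>"
        unfolding q_def y_def d_def using s[OF jN] t by (intro hilbert_dist_homotheties_le p ei xi) auto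
      ultimately have "hilbert_dist K (q j) y \<le> 3 * \<eta>"
        using small[OF e(1) x(1)] q(2)[OF jN] by linarith
      then show "homothety p t x \<in> A" using jN yi by (auto simp: A_def hilbert_ball_def y_def)
    qed
    moreover have "A \<in> sets borel"
      unfolding A_def using q by (intro sets.finite_UN hilbert_ball_borel) auto
    moreover have "emeasure hilbert_vol A \<le> ennreal (C * (R + 1) * \<eta> ^ (DIM('a) - 1))"
    proof -
      have "emeasure hilbert_vol A \<le> (\<Sum>j\<le>N. emeasure hilbert_vol (hilbert_ball K (q j) (3 * \<eta>)))"
        unfolding A_def using q by (intro emeasure_subadditive_finite) (auto intro: hilbert_ball_borel)
      also have "\<dots> \<le> (\<Sum>j\<le>N. ennreal (B * (3 * \<eta>) ^ DIM('a)))"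
        unfolding B_def using q \<eta> by (intro sum_mono emeasure_small_ball_le) auto
      also have "\<dots> = ennreal ((real N + 1) * (B * (3 * \<eta>) ^ DIM('a)))"
        using B \<eta> by (simp add: ennreal_mult' ennreal_of_nat_eq_real_of_nat[symmetric] ac_simps)
      also have "(real N + 1) * (B * (3 * \<eta>) ^ DIM('a))
          = B * 3 ^ DIM('a) * (real N * \<eta> + \<eta>) * \<eta> ^ (DIM('a) - 1)"
        by (subst power_mult_distrib, subst power_minus_mult[of "DIM('a)" \<eta>, symmetric])
          (simp_all add: algebra_simps)
      also have "ennreal \<dots> \<le> ennreal (C * (R + 1) * \<eta> ^ (DIM('a) - 1))"
        unfolding C_eq using B N \<eta> by (intro ennreal_leI mult_right_mono mult_left_mono) auto
      finally show ?thesis .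
    qed
    ultimately show ?thesis by blast
  qed
qed

text \<open>The cones over the members of the cover exhaust the ball. A member of diameter 0
  contributes nothing to the right-hand side, so the cone over it must be shown to be null; it
  is, because in dimension at least 2 the bound of \<open>small_cone_cover\<close> tends to 0 with \<open>\<eta>\<close>.\<close>

lemma vol_le_hausdorff_sum:
  fixes E :: "nat \<Rightarrow> 'a set"
  assumes dim: "2 \<le> DIM('a)" and p: "p \<in> interior K" and R: "0 \<le> R"
    and E: "\<And>i. E i \<subseteq> interior K"
    and diam: "\<And>i. diam_of (hilbert_dist K) (E i) \<le> ennreal (1 / 6)"
    and cover: "hilbert_sphere K p R \<subseteq> (\<Union>i. E i)"
  defines "C \<equiv> exp DIM('a) * unit_ball_vol DIM('a) * 9 ^ DIM('a)"
  shows "emeasure hilbert_vol (hilbert_ball K p R) \<le> ennreal (C * (R + 1)) *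
    (\<Sum>i. if E i = {} then 0 else diam_of (hilbert_dist K) (E i) ^ (DIM('a) - 1))"
proof -
  have C: "0 < C" by (simp add: C_def)
  define D where "D i = diam_of (hilbert_dist K) (E i)" for i
  define cn where "cn i = {homothety p s x | s x. 0 \<le> s \<and> s \<le> 1 \<and> x \<in> E i \<inter> hilbert_sphere K p R}" for i
  have "\<exists>A \<in> sets borel. cn i \<subseteq> A \<and>
    emeasure hilbert_vol A \<le> ennreal (C * (R + 1)) * (if E i = {} then 0 else D i ^ (DIM('a) - 1))" for i
  proof (cases "E i = {}")
    case True
    then have "cn i = {}" by (auto simp: cn_def)
    then show ?thesis by (intro bexI[of _ "{}"]) auto
  next
    case False
    have "D i < top" using diam[of i] by (auto simp: D_def intro: le_less_trans)
    define \<delta> where "\<delta> = enn2real (D i)"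
    have \<delta>: "0 \<le> \<delta>" and D: "D i = ennreal \<delta>" using \<open>D i < top\<close> by (auto simp: \<delta>_def)
    have \<delta>6: "\<delta> \<le> 1 / 6" using diam[of i] by (simp add: D[unfolded D_def])
    have dist: "hilbert_dist K x y \<le> \<delta>" if "x \<in> E i" "y \<in> E i" for x y
      using dist_le_diam_of[OF that, of "hilbert_dist K"] \<delta> by (simp add: D[unfolded D_def])
    show ?thesis
    proof (cases "\<delta> = 0")
      case False
      then have "\<exists>A \<in> sets borel. cn i \<subseteq> A \<and>
          emeasure hilbert_vol A \<le> ennreal (C * (R + 1) * \<delta> ^ (DIM('a) - 1))"
        unfolding cn_def C_def using \<delta> \<delta>6 dist by (intro small_cone_cover p R E) auto
      then show ?thesis using \<open>E i \<noteq> {}\<close> C R \<delta> by (simp add: D ennreal_power ennreal_mult)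
    next
      case True
      \<comment> \<open>diameter 0: every admissible thickness \<open>\<eta>\<close> may be used, and the covers are intersected\<close>
      define \<eta> where "\<eta> m = 1 / (real m + 6)" for m :: nat
      have \<eta>: "0 < \<eta> m" "\<eta> m \<le> 1 / 6" for m by (auto simp: \<eta>_def field_simps)
      have "\<exists>A \<in> sets borel. cn i \<subseteq> A \<and>
          emeasure hilbert_vol A \<le> ennreal (C * (R + 1) * \<eta> m ^ (DIM('a) - 1))" for m
      proof -
        have "hilbert_dist K x y \<le> \<eta> m" if "x \<in> E i" "y \<in> E i" for x y
          using dist[OF that] \<eta>[of m] True by linarith
        then show ?thesis unfolding cn_def C_def using \<eta> by (intro small_cone_cover p R E) auto
      qed
      then obtain A where A: "\<And>m. A m \<in> sets borel" "\<And>m. cn i \<subseteq> A m"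
        "\<And>m. emeasure hilbert_vol (A m) \<le> ennreal (C * (R + 1) * \<eta> m ^ (DIM('a) - 1))"
        by metis
      have le: "emeasure hilbert_vol (\<Inter>m. A m) \<le> ennreal (C * (R + 1) * \<eta> m)" for m
      proof -
        have "emeasure hilbert_vol (\<Inter>m. A m) \<le> emeasure hilbert_vol (A m)"
          using A(1) by (intro emeasure_mono) auto
        also note A(3)[of m]
        also have "ennreal (C * (R + 1) * \<eta> m ^ (DIM('a) - 1)) \<le> ennreal (C * (R + 1) * \<eta> m)"
          using C R \<eta>[of m] dim power_decreasing[of 1 "DIM('a) - 1" "\<eta> m"]
          by (intro ennreal_leI mult_left_mono) auto
        finally show ?thesis .
      qed
      have "(\<lambda>m. 1 / (real m + 6)) \<longlonglongrightarrow> 0"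
        using LIMSEQ_ignore_initial_segment[OF lim_1_over_n, of 6] by (simp add: add.commute)
      then have "(\<lambda>m. ennreal (C * (R + 1) * \<eta> m)) \<longlonglongrightarrow> ennreal (C * (R + 1) * 0)"
        unfolding \<eta>_def by (intro tendsto_intros)
      from LIMSEQ_le_const[OF this] le have "emeasure hilbert_vol (\<Inter>m. A m) = 0"
        by (metis mult_zero_right ennreal_0 le_zero_eq)
      moreover have "(\<Inter>m. A m) \<in> sets borel" using A(1) by (intro sets.countable_INT) auto
      moreover have "cn i \<subseteq> (\<Inter>m. A m)" using A(2) by blast
      ultimately show ?thesis by (intro bexI[of _ "\<Inter>m. A m"]) auto
    qed
  qed
  then obtain A where A: "\<And>i. A i \<in> sets borel" "\<And>i. cn i \<subseteq> A i"
    "\<And>i. emeasure hilbert_vol (A i) \<le> ennreal (C * (R + 1)) * (if E i = {} then 0 else D i ^ (DIM('a) - 1))"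
    by metis
  have sub: "hilbert_ball K p R \<subseteq> (\<Union>i. A i)"
  proof
    fix y assume "y \<in> hilbert_ball K p R"
    then obtain x s where x: "x \<in> hilbert_sphere K p R" and s: "0 \<le> s" "s \<le> 1" "y = homothety p s x"
      using ball_point_below_sphere[OF p _ R] by metis
    obtain i where "x \<in> E i" using x cover by blast
    then have "y \<in> cn i" using x s by (auto simp: cn_def)
    then show "y \<in> (\<Union>i. A i)" using A(2) by blast
  qed
  have "emeasure hilbert_vol (hilbert_ball K p R) \<le> emeasure hilbert_vol (\<Union>i. A i)"
    using A(1) sub by (intro emeasure_mono) auto
  also have "\<dots> \<le> (\<Sum>i. emeasure hilbert_vol (A i))"
    using A(1) by (intro emeasure_subadditive_countably) auto
  also have "\<dots> \<le> (\<Sum>i. ennreal (C * (R + 1)) * (if E i = {} then 0 else D i ^ (DIM('a) - 1)))"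
    by (intro suminf_le A(3) summableI)
  also have "\<dots> = ennreal (C * (R + 1)) * (\<Sum>i. if E i = {} then 0 else D i ^ (DIM('a) - 1))"
    by (rule ennreal_suminf_cmult)
  finally show "emeasure hilbert_vol (hilbert_ball K p R) \<le> ennreal (C * (R + 1)) *
      (\<Sum>i. if E i = {} then 0 else diam_of (hilbert_dist K) (E i) ^ (DIM('a) - 1))"
    by (simp only: D_def)
qed

text \<open>The premeasure at scale \<open>1/6\<close> bounds the Hausdorff measure from below, and
  \<open>vol_le_hausdorff_sum\<close> bounds each of the sums of which it is the infimum.\<close>

lemma vol_le_area:
  assumes dim: "2 \<le> DIM('a)" and p: "p \<in> interior K" and R: "0 \<le> R"
  defines "D \<equiv> exp DIM('a) * unit_ball_vol DIM('a) * 9 ^ DIM('a) * 2 ^ (DIM('a) - 1)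
      / unit_ball_vol (real (DIM('a) - 1))"
  shows "emeasure hilbert_vol (hilbert_ball K p R)
    \<le> ennreal (D * (R + 1)) * busemann_area K (hilbert_sphere K p R)"
proof -
  let ?n = "DIM('a) - 1"
  define \<kappa> where "\<kappa> = unit_ball_vol (real ?n) / 2 ^ ?n"
  have \<kappa>: "0 < \<kappa>" by (simp add: \<kappa>_def)
  define C where "C = exp DIM('a) * unit_ball_vol DIM('a) * 9 ^ DIM('a)"
  have C: "0 < C" by (simp add: C_def)
  have D: "D = C / \<kappa>" by (simp add: D_def C_def \<kappa>_def)
  let ?V = "emeasure hilbert_vol (hilbert_ball K p R)" and ?c = "ennreal (D * (R + 1))"
  have c: "0 < ?c" "?c < top" using C \<kappa> R by (auto simp: D)
  have "?V / ?c \<le> hausdorff_premeasure (interior K) (hilbert_dist K) ?n (1 / 6) (hilbert_sphere K p R)"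
    unfolding hausdorff_premeasure_def \<kappa>_def[symmetric]
  proof (rule INF_greatest)
    fix E :: "nat \<Rightarrow> 'a set"
    assume E: "E \<in> {E. (\<forall>i. E i \<subseteq> interior K \<and> diam_of (hilbert_dist K) (E i) \<le> ennreal (1 / 6)) \<and>
      hilbert_sphere K p R \<subseteq> (\<Union>i. E i)}"
    let ?f = "\<lambda>i. if E i = {} then 0 else diam_of (hilbert_dist K) (E i) ^ ?n"
    have "?V \<le> ennreal (C * (R + 1)) * (\<Sum>i. ?f i)" using E unfolding C_def by (intro vol_le_hausdorff_sum dim p R) auto
    also have "ennreal (C * (R + 1)) = ?c * ennreal \<kappa>"
      using C \<kappa> R by (simp add: D flip: ennreal_mult)
    also have "?c * ennreal \<kappa> * (\<Sum>i. ?f i) = ?c * (\<Sum>i. ennreal \<kappa> * ?f i)"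
      by (simp add: mult.assoc)
    also have "(\<lambda>i. ennreal \<kappa> * ?f i)
        = (\<lambda>i. if E i = {} then 0 else ennreal \<kappa> * diam_of (hilbert_dist K) (E i) ^ ?n)"
      by auto
    finally show "?V / ?c \<le> (\<Sum>i. if E i = {} then 0 else ennreal \<kappa> * diam_of (hilbert_dist K) (E i) ^ ?n)"
      using c by (intro divide_le_posI_ennreal) auto
  qed
  also have "\<dots> \<le> busemann_area K (hilbert_sphere K p R)"
    unfolding busemann_area_def hausdorff_measure_def by (rule SUP_upper) simp
  finally have "?c * (?V / ?c) \<le> ?c * busemann_area K (hilbert_sphere K p R)"
    by (rule mult_left_mono) simp
  also have "?c * (?V / ?c) = ?V"
    unfolding ennreal_times_divide mult.commute[of ?c]
    using c by (intro mult_divide_eq_ennreal) auto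
  finally show "?V \<le> ?c * busemann_area K (hilbert_sphere K p R)" .
qed

section \<open>The area of a sphere is bounded by the volume of a larger ball\<close>

text \<open>Each of the about \<open>1 / \<delta>\<close> spheres of radii \<open>r + j \<delta>\<close> carries a copy of \<open>X\<close>, obtained by
  moving its points outwards along rays. Since the radial projection back to \<open>X\<close> is 2-Lipschitz,
  the copies are more than \<open>\<delta> / 2\<close>-separated, and points on different spheres are at distance at
  least \<open>\<delta>\<close>. Hence the balls of radius \<open>\<delta> / 4\<close> about all these points are disjoint; in the
  constant, \<open>16\<close> is the factor \<open>4\<close> of the lower volume estimate times the \<open>4\<close> of \<open>\<delta> / 4\<close>.\<close>

lemma separated_card_bound:
  assumes p: "p \<in> interior K" and r: "0 \<le> r" and \<delta>: "0 < \<delta>" "\<delta> \<le> 1"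
    and X: "finite X" "X \<subseteq> hilbert_sphere K p r"
    and sep: "\<And>x y. x \<in> X \<Longrightarrow> y \<in> X \<Longrightarrow> x \<noteq> y \<Longrightarrow> \<delta> < hilbert_dist K x y"
  defines "c \<equiv> exp (- DIM('a)) * unit_ball_vol DIM('a) / 16 ^ DIM('a)"
  shows "ennreal (real (card X) * (c * \<delta> ^ (DIM('a) - 1))) \<le> emeasure hilbert_vol (hilbert_ball K p (r + 2))"
proof -
  define J where "J = nat \<lfloor>1 / \<delta>\<rfloor>"
  have "real J = of_int \<lfloor>1 / \<delta>\<rfloor>" using \<delta> by (simp add: J_def)
  then have "real J \<le> 1 / \<delta>" "1 / \<delta> < real J + 1" by linarith+
  then have J: "real J * \<delta> \<le> 1" "1 \<le> (real J + 1) * \<delta>" using \<delta> by (simp_all add: field_simps)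
  have level: "real j * \<delta> \<le> 1" if "j \<le> J" for j
  proof -
    have "real j * \<delta> \<le> real J * \<delta>" using that \<delta> by (intro mult_right_mono) auto
    then show ?thesis using J by linarith
  qed
  have "\<exists>y s. y \<in> hilbert_sphere K p (r + real j * \<delta>) \<and> 0 \<le> s \<and> s \<le> 1 \<and> x = homothety p s y"
    if "x \<in> X" for x j
  proof -
    have "x \<in> hilbert_ball K p (r + real j * \<delta>)"
      using that X \<delta> by (auto simp: hilbert_ball_def hilbert_sphere_def)
    moreover have "0 \<le> r + real j * \<delta>" using r \<delta> by simp
    ultimately show ?thesis using ball_point_below_sphere[OF p] by metis
  qed
  then obtain Y S where YS: "\<And>x j. x \<in> X \<Longrightarrow> Y x j \<in> hilbert_sphere K p (r + real j * \<delta>) \<and>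
      0 \<le> S x j \<and> S x j \<le> 1 \<and> x = homothety p (S x j) (Y x j)"
    by metis
  define I where "I = X \<times> {..J}"
  define B where "B = (\<lambda>(x, j). hilbert_ball K (Y x j) (\<delta> / 4))"
  have Yi: "Y x j \<in> interior K" "hilbert_dist K p (Y x j) = r + real j * \<delta>" if "x \<in> X" for x j
    using YS[OF that] by (auto simp: hilbert_sphere_def)
  have Ysep: "\<delta> / 2 < hilbert_dist K (Y x j) (Y x' j')" if "x \<in> X" "x' \<in> X" "(x, j) \<noteq> (x', j')" for x x' j j'
  proof (cases "j = j'")
    case True
    then have "\<delta> < hilbert_dist K x x'" using that sep by auto
    also have "\<dots> = hilbert_dist K (homothety p (S x j) (Y x j)) (homothety p (S x' j') (Y x' j'))"
      using YS that by simp
    also have "\<dots> \<le> 2 * hilbert_dist K (Y x j) (Y x' j') + \<bar>hilbert_dist K p x - hilbert_dist K p x'\<bar>"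
      using hilbert_dist_homotheties_le[OF p Yi(1)[OF that(1), of j] Yi(1)[OF that(2), of j'], of "S x j" "S x' j'"]
        YS[OF that(1), of j] YS[OF that(2), of j'] by simp
    also have "\<bar>hilbert_dist K p x - hilbert_dist K p x'\<bar> = 0"
      using that X by (auto simp: hilbert_sphere_def subset_iff)
    finally show ?thesis by simp
  next
    case False
    then have "1 \<le> \<bar>real j - real j'\<bar>" by linarith
    then have "\<delta> \<le> \<bar>real j - real j'\<bar> * \<delta>" using \<delta> by simp
    also have "\<dots> = \<bar>(real j - real j') * \<delta>\<bar>" using \<delta> by (simp add: abs_mult)
    also have "\<dots> = \<bar>hilbert_dist K p (Y x j) - hilbert_dist K p (Y x' j')\<bar>"
      using Yi that by (simp add: algebra_simps)
    also have "\<dots> \<le> hilbert_dist K (Y x j) (Y x' j')"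
      using Yi that by (intro hilbert_dist_triangle_abs p) auto
    finally show ?thesis using \<delta> by linarith
  qed
  have disj: "disjoint_family_on B I"
    unfolding disjoint_family_on_def
  proof (intro ballI impI)
    fix a b assume a: "a \<in> I" and b: "b \<in> I" and ne: "a \<noteq> b"
    obtain x j x' j' where ab: "a = (x, j)" "b = (x', j')" by (metis surj_pair)
    have x: "x \<in> X" "x' \<in> X" using a b by (auto simp: ab I_def)
    have False if z: "z \<in> B a" "z \<in> B b" for z
    proof -
      have zi: "z \<in> interior K" and "hilbert_dist K (Y x j) z \<le> \<delta> / 4" "hilbert_dist K (Y x' j') z \<le> \<delta> / 4"
        using z by (auto simp: ab B_def hilbert_ball_def)
      then show False
        using Ysep[OF x, of j j'] ne hilbert_dist_triangle[OF Yi(1)[OF x(1)] zi Yi(1)[OF x(2)], of j j']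
          hilbert_dist_sym[OF zi Yi(1)[OF x(2)], of j'] ab by auto
    qed
    then show "B a \<inter> B b = {}" by blast
  qed
  have Bborel: "B a \<in> sets borel" if "a \<in> I" for a
    using that Yi by (auto simp: B_def I_def intro: hilbert_ball_borel)
  have Bsub: "B a \<subseteq> hilbert_ball K p (r + 2)" if "a \<in> I" for a
  proof
    fix z assume z: "z \<in> B a"
    obtain x j where a: "a = (x, j)" by (metis surj_pair)
    have x: "x \<in> X" "j \<le> J" using that by (auto simp: a I_def)
    have zi: "z \<in> interior K" and "hilbert_dist K (Y x j) z \<le> \<delta> / 4"
      using z by (auto simp: a B_def hilbert_ball_def)
    then have "hilbert_dist K p z \<le> r + 2"
      using hilbert_dist_triangle[OF p Yi(1)[OF x(1)] zi, of j] Yi(2)[OF x(1), of j] level[OF x(2)] \<delta>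
      by linarith
    then show "z \<in> hilbert_ball K p (r + 2)" using zi by (simp add: hilbert_ball_def)
  qed
  have finI: "finite I" using X by (simp add: I_def)
  define b where "b = exp (- DIM('a)) * unit_ball_vol DIM('a) / 4 ^ DIM('a) * (\<delta> / 4) ^ DIM('a)"
  have b: "0 \<le> b" using \<delta> by (simp add: b_def)
  have "c * \<delta> ^ (DIM('a) - 1) \<le> (real J + 1) * b"
  proof -
    have c: "0 < c" by (simp add: c_def)
    have "(16::real) ^ DIM('a) = 4 ^ DIM('a) * 4 ^ DIM('a)" by (simp flip: power_mult_distrib)
    then have "b = c * \<delta> ^ DIM('a)" by (simp add: b_def c_def power_divide)
    also have "\<dots> = c * \<delta> ^ (DIM('a) - 1) * \<delta>"
      using power_minus_mult[of "DIM('a)" \<delta>] by simp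
    finally have "(real J + 1) * b = c * \<delta> ^ (DIM('a) - 1) * ((real J + 1) * \<delta>)"
      by (simp add: mult_ac)
    moreover have "c * \<delta> ^ (DIM('a) - 1) * 1 \<le> c * \<delta> ^ (DIM('a) - 1) * ((real J + 1) * \<delta>)"
      using J c \<delta> by (intro mult_left_mono) auto
    ultimately show ?thesis by (simp only: mult_1_right)
  qed
  then have "ennreal (real (card X) * (c * \<delta> ^ (DIM('a) - 1))) \<le> ennreal (real (card X) * ((real J + 1) * b))"
    by (intro ennreal_leI mult_left_mono) auto
  also have "real (card X) * ((real J + 1) * b) = real (card I) * b"
    by (simp add: I_def card_cartesian_product algebra_simps)
  also have "ennreal \<dots> = (\<Sum>a\<in>I. ennreal b)"
    using b by (simp add: ennreal_mult ennreal_of_nat_eq_real_of_nat)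
  also have "\<dots> \<le> (\<Sum>a\<in>I. emeasure hilbert_vol (B a))"
  proof (rule sum_mono)
    fix a assume "a \<in> I"
    then obtain x j where a: "a = (x, j)" and x: "x \<in> X" by (auto simp: I_def)
    show "ennreal b \<le> emeasure hilbert_vol (B a)"
      unfolding b_def B_def a prod.case
      using \<delta> x by (intro emeasure_small_ball_ge Yi) auto
  qed
  also have "\<dots> = emeasure hilbert_vol (\<Union>a\<in>I. B a)"
    using Bborel by (intro sum_emeasure disj finI) auto
  also have "\<dots> \<le> emeasure hilbert_vol (hilbert_ball K p (r + 2))"
    using Bsub hilbert_ball_borel[OF p] by (intro emeasure_mono) auto
  finally show ?thesis .
qed

text \<open>By \<open>separated_card_bound\<close> the cardinality of separated subsets is bounded; one of maximal
  cardinality is a net.\<close>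

lemma sphere_net:
  assumes p: "p \<in> interior K" and r: "0 \<le> r" and \<delta>: "0 < \<delta>" "\<delta> \<le> 1"
  shows "\<exists>X. finite X \<and> X \<subseteq> hilbert_sphere K p r \<and>
    (\<forall>x\<in>X. \<forall>y\<in>X. x \<noteq> y \<longrightarrow> \<delta> < hilbert_dist K x y) \<and>
    hilbert_sphere K p r \<subseteq> (\<Union>x\<in>X. hilbert_ball K x \<delta>)"
proof -
  \<comment> \<open>finiteness of the volume is what bounds the cardinality\<close>
  define V where "V = enn2real (emeasure hilbert_vol (hilbert_ball K p (r + 2)))"
  have V: "emeasure hilbert_vol (hilbert_ball K p (r + 2)) = ennreal V"
    using emeasure_ball_finite[OF p] by (simp add: V_def)
  define sepd where "sepd X \<longleftrightarrow> finite X \<and> X \<subseteq> hilbert_sphere K p r \<and>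
    (\<forall>x\<in>X. \<forall>y\<in>X. x \<noteq> y \<longrightarrow> \<delta> < hilbert_dist K x y)" for X
  define b where "b = exp (- DIM('a)) * unit_ball_vol DIM('a) / 16 ^ DIM('a) * \<delta> ^ (DIM('a) - 1)"
  have b: "0 < b" using \<delta> by (simp add: b_def)
  have bound: "card X \<le> nat \<lfloor>V / b\<rfloor>" if "sepd X" for X
  proof -
    have "ennreal (real (card X) * b) \<le> ennreal V"
      using separated_card_bound[OF p r \<delta>, of X] that unfolding b_def V[symmetric] sepd_def by blast
    then have "real (card X) * b \<le> V" by (simp add: V_def)
    then have "real (card X) \<le> V / b" using b by (simp add: field_simps)
    then show ?thesis by (simp add: le_nat_floor)
  qed
  have "sepd {}" by (simp add: sepd_def)
  then have "\<exists>k. (\<exists>X. sepd X \<and> card X = k) \<and> (\<forall>k'. (\<exists>X. sepd X \<and> card X = k') \<longrightarrow> k' \<le> k)"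
    using bound by (intro Nat.ex_has_greatest_nat[where b = "nat \<lfloor>V / b\<rfloor>" and k = 0])
      (auto intro: exI[of _ "{}"])
  then obtain X where X: "sepd X" and max: "\<And>X'. sepd X' \<Longrightarrow> card X' \<le> card X" by blast
  have Xi: "X \<subseteq> interior K" using X by (auto simp: sepd_def hilbert_sphere_def)
  have "hilbert_sphere K p r \<subseteq> (\<Union>x\<in>X. hilbert_ball K x \<delta>)"
  proof (rule ccontr)
    assume "\<not> hilbert_sphere K p r \<subseteq> (\<Union>x\<in>X. hilbert_ball K x \<delta>)"
    then obtain y where y: "y \<in> hilbert_sphere K p r" "\<And>x. x \<in> X \<Longrightarrow> y \<notin> hilbert_ball K x \<delta>" by blast
    have yi: "y \<in> interior K" using y by (simp add: hilbert_sphere_def)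
    have far: "\<delta> < hilbert_dist K x y" if "x \<in> X" for x
      using y(2)[OF that] yi by (simp add: hilbert_ball_def)
    have far': "\<delta> < hilbert_dist K y x" if "x \<in> X" for x
      using far[OF that] hilbert_dist_sym[OF yi, of x] that Xi by auto
    have "y \<notin> X" using far \<delta> by force
    moreover have "sepd (insert y X)" using X far far' y(1) by (auto simp: sepd_def)
    ultimately show False using max[of "insert y X"] X by (simp add: sepd_def)
  qed
  with X show ?thesis unfolding sepd_def by blast
qed

text \<open>The cover by the balls of radius \<open>\<delta>\<close> about a \<open>\<delta>\<close>-separated net has a Hausdorff sum
  of at most a constant, independent of \<open>\<delta>\<close>, times the quantity that \<open>separated_card_bound\<close> bounds
  by the volume.\<close>

lemma premeasure_le_vol:
  assumes p: "p \<in> interior K" and r: "0 \<le> r" and \<epsilon>: "0 < \<epsilon>"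
  defines "C \<equiv> unit_ball_vol (real (DIM('a) - 1)) * exp DIM('a) * 16 ^ DIM('a) / unit_ball_vol DIM('a)"
  shows "hausdorff_premeasure (interior K) (hilbert_dist K) (DIM('a) - 1) \<epsilon> (hilbert_sphere K p r)
    \<le> ennreal C * emeasure hilbert_vol (hilbert_ball K p (r + 2))"
proof -
  let ?n = "DIM('a) - 1"
  define \<delta> where "\<delta> = min (\<epsilon> / 2) 1"
  have \<delta>: "0 < \<delta>" "\<delta> \<le> 1" "2 * \<delta> \<le> \<epsilon>" using \<epsilon> by (auto simp: \<delta>_def)
  obtain X where X: "finite X" "X \<subseteq> hilbert_sphere K p r"
    and sep: "\<And>x y. x \<in> X \<Longrightarrow> y \<in> X \<Longrightarrow> x \<noteq> y \<Longrightarrow> \<delta> < hilbert_dist K x y"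
    and net: "hilbert_sphere K p r \<subseteq> (\<Union>x\<in>X. hilbert_ball K x \<delta>)"
    using sphere_net[OF p r \<delta>(1,2)] by blast
  have Xi: "X \<subseteq> interior K" using X by (auto simp: hilbert_sphere_def)
  obtain f where f: "bij_betw f {..<card X} X"
    using ex_bij_betw_nat_finite[OF X(1)] by (auto simp: atLeast0LessThan)
  define E where "E i = (if i < card X then hilbert_ball K (f i) \<delta> else {})" for i
  have fi: "f i \<in> X" if "i < card X" for i using f that by (auto simp: bij_betw_def)
  have diam: "diam_of (hilbert_dist K) (E i) \<le> ennreal (2 * \<delta>)" for i
    unfolding diam_of_def
  proof (intro SUP_least ennreal_leI)
    fix x y assume xy: "x \<in> E i" "y \<in> E i"
    then have i: "i < card X" by (auto simp: E_def split: if_splits)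
    have z: "f i \<in> interior K" using fi[OF i] Xi by blast
    have xi: "x \<in> interior K" "hilbert_dist K (f i) x \<le> \<delta>" and yi: "y \<in> interior K" "hilbert_dist K (f i) y \<le> \<delta>"
      using xy i by (auto simp: E_def hilbert_ball_def)
    show "hilbert_dist K x y \<le> 2 * \<delta>"
      using hilbert_dist_triangle[OF xi(1) z yi(1)] hilbert_dist_sym[OF z xi(1)] xi yi by linarith
  qed
  have cover: "hilbert_sphere K p r \<subseteq> (\<Union>i. E i)"
  proof
    fix y assume "y \<in> hilbert_sphere K p r"
    then obtain x where x: "x \<in> X" "y \<in> hilbert_ball K x \<delta>" using net by blast
    have "x \<in> f ` {..<card X}" using x f by (simp add: bij_betw_def)
    then obtain i where "i < card X" "f i = x" by auto
    then have "y \<in> E i" using x by (simp add: E_def)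
    then show "y \<in> (\<Union>i. E i)" by blast
  qed
  define \<kappa> where "\<kappa> = unit_ball_vol (real ?n) / 2 ^ ?n"
  have \<kappa>: "0 < \<kappa>" by (simp add: \<kappa>_def)
  define c where "c = exp (- DIM('a)) * unit_ball_vol DIM('a) / 16 ^ DIM('a)"
  have c: "0 < c" by (simp add: c_def)
  have "unit_ball_vol (real DIM('a)) \<noteq> 0"
    using unit_ball_vol_pos[of "real DIM('a)"] by (metis less_irrefl of_nat_0_le_iff)
  then have Cc: "\<kappa> * 2 ^ ?n = C * c" by (simp add: C_def c_def \<kappa>_def exp_minus)
  have C: "0 < C" by (simp add: C_def)
  have E: "E \<in> {E. (\<forall>i. E i \<subseteq> interior K \<and> diam_of (hilbert_dist K) (E i) \<le> ennreal \<epsilon>) \<and>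
      hilbert_sphere K p r \<subseteq> (\<Union>i. E i)}"
    using cover diam order_trans[OF diam ennreal_leI[OF \<delta>(3)]] by (auto simp: E_def hilbert_ball_def)
  have "hausdorff_premeasure (interior K) (hilbert_dist K) ?n \<epsilon> (hilbert_sphere K p r)
      \<le> (\<Sum>i. if E i = {} then 0 else ennreal \<kappa> * diam_of (hilbert_dist K) (E i) ^ ?n)"
    unfolding hausdorff_premeasure_def \<kappa>_def by (rule INF_lower[OF E])
  also have "\<dots> = (\<Sum>i<card X. if E i = {} then 0 else ennreal \<kappa> * diam_of (hilbert_dist K) (E i) ^ ?n)"
    by (rule suminf_finite) (auto simp: E_def)
  also have "\<dots> \<le> (\<Sum>i<card X. ennreal (\<kappa> * (2 * \<delta>) ^ ?n))"
  proof (rule sum_mono)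
    fix i
    have "ennreal \<kappa> * diam_of (hilbert_dist K) (E i) ^ ?n \<le> ennreal \<kappa> * ennreal (2 * \<delta>) ^ ?n"
      by (intro mult_left_mono power_mono diam) auto
    also have "\<dots> = ennreal (\<kappa> * (2 * \<delta>) ^ ?n)"
      using \<kappa> \<delta> by (subst ennreal_power) (auto intro: ennreal_mult[symmetric])
    finally show "(if E i = {} then 0 else ennreal \<kappa> * diam_of (hilbert_dist K) (E i) ^ ?n)
        \<le> ennreal (\<kappa> * (2 * \<delta>) ^ ?n)" by simp
  qed
  also have "\<dots> = ennreal (real (card X) * (\<kappa> * (2 * \<delta>) ^ ?n))"
    using \<kappa> \<delta> by (simp add: ennreal_mult ennreal_of_nat_eq_real_of_nat)
  also have "real (card X) * (\<kappa> * (2 * \<delta>) ^ ?n) = C * (real (card X) * (c * \<delta> ^ ?n))"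
    using Cc by (simp add: power_mult_distrib mult_ac)
  also have "ennreal \<dots> = ennreal C * ennreal (real (card X) * (c * \<delta> ^ ?n))"
    using C c \<delta> by (intro ennreal_mult) auto
  also have "\<dots> \<le> ennreal C * emeasure hilbert_vol (hilbert_ball K p (r + 2))"
    unfolding c_def by (intro mult_left_mono separated_card_bound p r \<delta> X sep) auto
  finally show ?thesis .
qed

lemma area_le_vol:
  assumes p: "p \<in> interior K" and r: "0 \<le> r"
  defines "C \<equiv> unit_ball_vol (real (DIM('a) - 1)) * exp DIM('a) * 16 ^ DIM('a) / unit_ball_vol DIM('a)"
  shows "busemann_area K (hilbert_sphere K p r)
    \<le> ennreal C * emeasure hilbert_vol (hilbert_ball K p (r + 2))"
  unfolding busemann_area_def hausdorff_measure_def C_def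
  by (rule SUP_least) (rule premeasure_le_vol[OF p r], simp)

section \<open>Comparison of the entropies\<close>

text \<open>After logarithms and division by \<open>r\<close>, the factor \<open>D (r + 1)\<close> costs \<open>ln (D (r + 1)) / r\<close>,
  and the factor \<open>C\<close> together with the shift of the radius costs \<open>O(1 / r)\<close>.\<close>

lemma spherical_entropies_eq:
  assumes dim: "2 \<le> DIM('a)" and p: "p \<in> interior K"
  shows "Limsup at_top (\<lambda>r. ln_ennreal (busemann_area K (hilbert_sphere K p r)) / ereal r)
      = upper_vol_entropy K p"
    and "Liminf at_top (\<lambda>r. ln_ennreal (busemann_area K (hilbert_sphere K p r)) / ereal r)
      = lower_vol_entropy K p"
proof -
  define V where "V r = enn2real (emeasure hilbert_vol (hilbert_ball K p r))" for r
  define S where "S r = enn2real (busemann_area K (hilbert_sphere K p r))" for r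
  define v s where "v r = ln (V r) / r" and "s r = ln (S r) / r" for r
  define L where "L = busemann_density K p * measure lborel K"
  define C where "C = unit_ball_vol (real (DIM('a) - 1)) * exp DIM('a) * 16 ^ DIM('a) / unit_ball_vol DIM('a)"
  define D where "D = exp DIM('a) * unit_ball_vol DIM('a) * 9 ^ DIM('a) * 2 ^ (DIM('a) - 1)
      / unit_ball_vol (real (DIM('a) - 1))"
  have C: "0 < C" and D: "0 < D" by (simp_all add: C_def D_def)
  have V_eq: "busemann_vol K (hilbert_ball K p r) = ennreal (V r)"
    and V_em: "emeasure hilbert_vol (hilbert_ball K p r) = ennreal (V r)" for r
    using busemann_vol_eq[OF hilbert_ball_borel[OF p] hilbert_ball_subset_interior] emeasure_ball_finite[OF p]
    by (auto simp: V_def)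
  have V_mono: "V r \<le> V r'" if "r \<le> r'" for r r'
  proof -
    have "emeasure hilbert_vol (hilbert_ball K p r) \<le> emeasure hilbert_vol (hilbert_ball K p r')"
      using that hilbert_ball_borel[OF p] by (intro emeasure_mono) (auto simp: hilbert_ball_def)
    then show ?thesis by (simp add: V_em) (simp add: V_def)
  qed
  have V_half: "0 < V (1 / 2)"
  proof -
    have "0 < ennreal (exp (- DIM('a)) * unit_ball_vol DIM('a) / 4 ^ DIM('a) * (1 / 2) ^ DIM('a))"
      by simp
    also have "\<dots> \<le> ennreal (V (1 / 2))"
      unfolding V_em[symmetric] by (intro emeasure_small_ball_ge p) auto
    finally show ?thesis by (simp add: V_def)
  qed
  have V_pos: "0 < V r" if "1 / 2 \<le> r" for r
    using V_half V_mono[OF that] by linarith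
  have V_le: "V r \<le> exp (2 * r * DIM('a)) * L" for r
    using emeasure_ball_le_exp[OF p, of r] busemann_density_pos[OF p] unfolding V_em L_def by simp
  have S_eq: "busemann_area K (hilbert_sphere K p r) = ennreal (S r)" if "0 \<le> r" for r
  proof -
    have "busemann_area K (hilbert_sphere K p r) \<le> ennreal C * ennreal (V (r + 2))"
      unfolding C_def V_em[symmetric] by (rule area_le_vol[OF p that])
    also have "\<dots> < top" by (simp add: ennreal_mult_less_top)
    finally show ?thesis by (simp add: S_def)
  qed
  have S_le: "S r \<le> C * V (r + 2)" if "0 \<le> r" for r
  proof -
    have "ennreal (S r) \<le> ennreal C * ennreal (V (r + 2))"
      unfolding C_def V_em[symmetric] S_eq[OF that, symmetric] by (rule area_le_vol[OF p that])
    also have "\<dots> = ennreal (C * V (r + 2))" using C by (simp add: ennreal_mult V_def)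
    finally show ?thesis using C by (simp add: V_def)
  qed
  have V_le_S: "V r \<le> D * (r + 1) * S r" if "0 \<le> r" for r
  proof -
    have "ennreal (V r) \<le> ennreal (D * (r + 1)) * ennreal (S r)"
      unfolding D_def V_em[symmetric] S_eq[OF that, symmetric] by (rule vol_le_area[OF dim p that])
    also have "\<dots> = ennreal (D * (r + 1) * S r)" using D that by (intro ennreal_mult[symmetric]) (auto simp: S_def)
    finally show ?thesis using D that by (simp add: S_def)
  qed
  have S_pos: "0 < S r" if "1 \<le> r" for r
  proof -
    have "0 < D * (r + 1) * S r" using V_pos[of r] V_le_S[of r] that by simp
    moreover have "0 < D * (r + 1)" using D that by simp
    ultimately show ?thesis by (rule zero_less_mult_pos)
  qed
  have "0 < exp (2 * (1 / 2) * DIM('a)) * L" using V_half V_le[of "1 / 2"] by linarith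
  then have L: "0 < L" by (rule zero_less_mult_pos) simp
  define M where "M = \<bar>ln (V (1 / 2))\<bar> + \<bar>ln L\<bar>"
  have lnV: "\<bar>ln (V r)\<bar> \<le> M + 2 * r * DIM('a)" if "1 \<le> r" for r
  proof -
    have "ln (V (1 / 2)) \<le> ln (V r)" using V_half V_mono[of "1 / 2" r] that by simp
    moreover have "ln (V r) \<le> ln (exp (2 * r * DIM('a)) * L)"
      using V_pos[of r] V_le[of r] that L by (subst ln_le_cancel_iff) auto
    then have "ln (V r) \<le> 2 * r * DIM('a) + ln L" using L by (simp add: ln_mult)
    moreover have "0 \<le> 2 * r * DIM('a)" using that by simp
    ultimately show ?thesis unfolding M_def by linarith
  qed
  have upper: "\<forall>\<^sub>F r in at_top. s r \<le> v (r + 2) + (\<bar>ln C\<bar> + 2 * M + 4 * DIM('a)) / r"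
  proof (rule eventually_mono[OF eventually_ge_at_top[of 1]])
    fix r :: real assume r: "1 \<le> r"
    have "ln (S r) \<le> ln (C * V (r + 2))"
      using S_pos[OF r] S_le[of r] C V_pos[of "r + 2"] r by (subst ln_le_cancel_iff) auto
    also have "\<dots> = ln C + ln (V (r + 2))" using C V_pos[of "r + 2"] r by (simp add: ln_mult)
    finally have "s r \<le> (ln C + ln (V (r + 2))) / r"
      using r unfolding s_def by (intro divide_right_mono) auto
    also have "\<dots> = v (r + 2) + (ln C + 2 * (ln (V (r + 2)) / (r + 2))) / r"
    proof -
      \<comment> \<open>dividing by \<open>r\<close> instead of \<open>r + 2\<close> costs \<open>2 w / r\<close>; \<open>w\<close> is bounded as \<open>ln (V r) = O(r)\<close>\<close>
      define w where "w = v (r + 2)"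
      have "ln (V (r + 2)) = w * (r + 2)" using r by (simp add: w_def v_def)
      then have "(ln C + ln (V (r + 2))) / r = w + (ln C + 2 * w) / r" using r by (simp add: field_simps)
      then show ?thesis by (simp add: w_def v_def)
    qed
    also have "\<dots> \<le> v (r + 2) + (\<bar>ln C\<bar> + 2 * M + 4 * DIM('a)) / r"
    proof -
      have "0 \<le> M" by (simp add: M_def)
      then have "M * 1 \<le> M * (r + 2)" using r by (intro mult_left_mono) auto
      then have "ln (V (r + 2)) \<le> (M + 2 * DIM('a)) * (r + 2)"
        using lnV[of "r + 2"] r by (simp add: algebra_simps)
      then have "ln (V (r + 2)) / (r + 2) \<le> M + 2 * DIM('a)" using r by (simp add: field_simps)
      then have "ln C + 2 * (ln (V (r + 2)) / (r + 2)) \<le> \<bar>ln C\<bar> + 2 * M + 4 * DIM('a)" by linarith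
      then show ?thesis using r by (intro add_left_mono divide_right_mono) auto
    qed
    finally show "s r \<le> v (r + 2) + (\<bar>ln C\<bar> + 2 * M + 4 * DIM('a)) / r" .
  qed
  have lower: "\<forall>\<^sub>F r in at_top. v r \<le> s r + ln (D * (r + 1)) / r"
  proof (rule eventually_mono[OF eventually_ge_at_top[of 1]])
    fix r :: real assume r: "1 \<le> r"
    have D1: "0 < D * (r + 1)" using D r by simp
    have "ln (V r) \<le> ln (D * (r + 1) * S r)"
      using V_pos[of r] V_le_S[of r] S_pos[OF r] D1 r by (subst ln_le_cancel_iff) auto
    also have "\<dots> = ln (D * (r + 1)) + ln (S r)"
      using D1 S_pos[OF r] by (simp only: ln_mult_pos)
    finally show "v r \<le> s r + ln (D * (r + 1)) / r"
      unfolding v_def s_def add_divide_distrib[symmetric] using r by (intro divide_right_mono) auto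
  qed
  have lim_upper: "((\<lambda>r. (\<bar>ln C\<bar> + 2 * M + 4 * DIM('a)) / r) \<longlongrightarrow> 0) at_top"
    by real_asymp
  have lim_lower: "((\<lambda>r. ln (D * (r + 1)) / r) \<longlongrightarrow> 0) at_top"
    using D by real_asymp
  note up = Limsup_Liminf_le_of_asymptotic_le[OF upper lim_upper]
    and lo = Limsup_Liminf_le_of_asymptotic_le[OF lower lim_lower]
  have eqs: "Limsup at_top (\<lambda>r. ereal (s r)) = Limsup at_top (\<lambda>r. ereal (v r))"
    "Liminf at_top (\<lambda>r. ereal (s r)) = Liminf at_top (\<lambda>r. ereal (v r))"
    using up lo Limsup_Liminf_shift[of "\<lambda>r. ereal (v r)" 2] by (auto intro: antisym)
  have ev_s: "\<forall>\<^sub>F r in at_top. ln_ennreal (busemann_area K (hilbert_sphere K p r)) / ereal r = ereal (s r)"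
    by (rule eventually_mono[OF eventually_ge_at_top[of 1]])
      (simp add: S_eq ln_ennreal_ennreal S_pos s_def)
  have ev_v: "\<forall>\<^sub>F r in at_top. ln_ennreal (busemann_vol K (hilbert_ball K p r)) / ereal r = ereal (v r)"
    by (rule eventually_mono[OF eventually_ge_at_top[of 1]])
      (simp add: V_eq ln_ennreal_ennreal V_pos v_def)
  show "Limsup at_top (\<lambda>r. ln_ennreal (busemann_area K (hilbert_sphere K p r)) / ereal r)
      = upper_vol_entropy K p"
    unfolding upper_vol_entropy_def Limsup_eq[OF ev_s] Limsup_eq[OF ev_v] by (rule eqs)
  show "Liminf at_top (\<lambda>r. ln_ennreal (busemann_area K (hilbert_sphere K p r)) / ereal r)
      = lower_vol_entropy K p"
    unfolding lower_vol_entropy_def Liminf_eq[OF ev_s] Liminf_eq[OF ev_v] by (rule eqs)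
qed

end
theorem theorem2p14:
  fixes K :: "'a::euclidean_space set" and p :: 'a
  assumes "DIM('a) \<ge> 2" and "convex_body K" and "p \<in> interior K"
  shows "Limsup at_top
           (\<lambda>r::real. ln_ennreal (busemann_area K (hilbert_sphere K p r)) / ereal r)
         = upper_vol_entropy K p
       \<and> Liminf at_top
           (\<lambda>r::real. ln_ennreal (busemann_area K (hilbert_sphere K p r)) / ereal r)
         = lower_vol_entropy K p"
proof -
  interpret hilbert_geometry K by unfold_locales (fact assms(2))
  show ?thesis using spherical_entropies_eq[OF assms(1,3)] by blast
qed

end
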